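(* In the setting described in the context (in particular $w,\varepsilon_k$ Gaussian; $x_k$ identically distributed with bounded support and common positive-definite covariance matrix $\overline Q$), let $\hat w_k^\dagger:=\mathbb{E}\{w|I_k\}$ be the Kalman-filter estimate of $w$ at time $k$ and $\mathrm{MSE}_k^\dagger:=\mathbb{E}\{(w-\hat w_k^\dagger)'(w-\hat w_k^\dagger)\}$. Then the following hold. (i) $\mathrm{MSE}_k^\dagger=\mathrm{Tr}\{\mathbb{E}\{\Sigma_k\}\}$. (ii) For every $k=1,2,\dots$, $$\mathrm{Tr}\{\mathbb{E}\{\Sigma_k\}\}\le\sqrt{\frac{(c_1+\sigma_\varepsilon^2)\,d\,\mathrm{Tr}\{\mathbb{E}\{\Sigma_0\}\}}{k\,\lambda_{\min}(\overline Q)}},$$ where $c_1$ is a positive constant such that $C_{k+1}\Sigma_{-1}C_{k+1}'\le c_1$ with a-priori probability $1$. Moreover, $\lim_{k\to+\infty}\mathrm{MSE}_k^\dagger=0$. (iii) $\lim_{k\to+\infty}\mathbb{E}\{H_k\}=0$. (iv) Every element $H_{k,(h,l)}$ of $H_k$ converges to $0$ also in probability, i.e., for every $\delta>0$, $\lim_{k\to+\infty}\Pr\{|H_{k,(h,l)}|>\delta\}=0$.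
   Context: A prime denotes transpose; $\lambda_{\min}$ denotes the smallest eigenvalue of a symmetric matrix. Data model: $w\in\mathbb{R}^d$ is a random vector, $x_k\in\mathbb{R}^d$ and $\varepsilon_k\in\mathbb{R}$ ($k=0,1,\dots$) are random inputs and noises; the random variables $w,\{x_k\},\{\varepsilon_k\}$ are mutually independent and have mean $0$; $w$ has covariance matrix $\Sigma_w$ and the $\varepsilon_k$ have the same variance $\sigma_\varepsilon^2>0$; $w$ and the $\varepsilon_k$ are Gaussian; the $x_k$ are identically distributed, their common probability distribution has bounded support, and $\mathbb{E}\{x_kx_k'\}=\overline Q$ is positive-definite. The outputs are $y_k=w'x_k+\varepsilon_k$. Put $C_k:=x_k'$. Information: the learning machine has $\hat w_0:=0$, $\hat w_{k+1}=\hat w_k+u_k$, where the update $u_k\in\mathbb{R}^d$ is a function of the information vector $I_k:=\{(x_j,y_j),\ j=0,\dots,k;\ u_j,\ j=0,\dots,k-1\}$ ($I_0:=\{(x_0,y_0)\}$). The error is $e_k:=\hat w_k-w$, with $\tilde y_k:=\hat w_k'x_k-y_k$ and $\tilde I_k:=\{(x_j,\tilde y_j),\ j=0,\dots,k;\ u_j,\ j=0,\dots,k-1\}$, in one-to-one correspondence with $I_k$. Covariances: $\Sigma_{-1}:=\Sigma_w$ and, for $k\ge0$, $\Sigma_k$ is the conditional covariance matrix of $e_k$ given $\tilde I_k$ (equivalently, of $w$ given $I_k$), i.e. the random matrix given by $\Sigma_k=\Sigma_{k-1}-\Sigma_{k-1}C_k'(C_k\Sigma_{k-1}C_k'+\sigma_\varepsilon^2)^{-1}C_k\Sigma_{k-1}$.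 The Kalman gain matrix is $H_k:=\Sigma_kC_k'(\sigma_\varepsilon^2)^{-1}$. Outer expectations are unconditional. In (ii) the inequality defining $c_1$ is meant for all $k$. *)

theory Defs
  imports "HOL-Probability.Probability"
begin

definition measure_support :: "'b::topological_space measure \<Rightarrow> 'b set" where
  "measure_support \<mu> = {p. \<forall>U. open U \<and> p \<in> U \<longrightarrow> 0 < emeasure \<mu> U}"

(* Normal laws of variance 0 (point masses) count as Gaussian, since a covariance matrix may be
   singular. *)
definition gaussian_rv :: "'a measure \<Rightarrow> ('a \<Rightarrow> real) \<Rightarrow> bool" where
  "gaussian_rv M X \<longleftrightarrow>
     X \<in> borel_measurable M \<and>
     ((\<exists>\<mu>. AE \<omega> in M. X \<omega> = \<mu>) \<or>
      (\<exists>\<mu> \<sigma>. \<sigma> > 0 \<and> distributed M lborel X (normal_density \<mu> \<sigma>)))"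

definition gaussian_vector :: "'a measure \<Rightarrow> ('a \<Rightarrow> real^'d) \<Rightarrow> bool" where
  "gaussian_vector M X \<longleftrightarrow>
     X \<in> borel_measurable M \<and> (\<forall>a. gaussian_rv M (\<lambda>\<omega>. a \<bullet> X \<omega>))"

definition outer :: "real^'d \<Rightarrow> real^'d \<Rightarrow> real^'d^'d" where
  "outer a b = (columnvector a :: real^1^'d) ** (rowvector b :: real^'d^1)"

definition cov_matrix :: "'a measure \<Rightarrow> ('a \<Rightarrow> real^'d) \<Rightarrow> real^'d^'d" where
  "cov_matrix M X =
     (\<integral>\<omega>. outer (X \<omega> - (\<integral>\<omega>'. X \<omega>' \<partial>M)) (X \<omega> - (\<integral>\<omega>'. X \<omega>' \<partial>M)) \<partial>M)"

definition positive_definite :: "real^'d^'d \<Rightarrow> bool" where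
  "positive_definite A \<longleftrightarrow> transpose A = A \<and> (\<forall>v. v \<noteq> 0 \<longrightarrow> 0 < v \<bullet> (A *v v))"

(* Meant for symmetric A, which has a smallest eigenvalue. *)
definition lambda_min :: "real^'d^'d \<Rightarrow> real" where
  "lambda_min A = (LEAST l. \<exists>v. v \<noteq> 0 \<and> A *v v = l *\<^sub>R v)"

(* I_k as a random vector: its first component is the family of the (x_j, y_j) for j \<le> k, its
   second one the family of the u_j for j < k. *)
definition info_space :: "nat \<Rightarrow> ((nat \<Rightarrow> (real^'d) \<times> real) \<times> (nat \<Rightarrow> real^'d)) measure" where
  "info_space k = (\<Pi>\<^sub>M j\<in>{..k}. borel) \<Otimes>\<^sub>M (\<Pi>\<^sub>M j\<in>{..<k}. borel)"

definition info ::
  "(nat \<Rightarrow> 'a \<Rightarrow> real^'d) \<Rightarrow> (nat \<Rightarrow> 'a \<Rightarrow> real) \<Rightarrow> (nat \<Rightarrow> 'a \<Rightarrow> real^'d) \<Rightarrow> nat \<Rightarrow> 'a \<Rightarrow>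
     (nat \<Rightarrow> (real^'d) \<times> real) \<times> (nat \<Rightarrow> real^'d)" where
  "info x y u k \<omega> = ((\<lambda>j\<in>{..k}. (x j \<omega>, y j \<omega>)), (\<lambda>j\<in>{..<k}. u j \<omega>))"

datatype source = Weight | Input nat | Noise nat

fun source_events ::
  "'a measure \<Rightarrow> ('a \<Rightarrow> real^'d) \<Rightarrow> (nat \<Rightarrow> 'a \<Rightarrow> real^'d) \<Rightarrow> (nat \<Rightarrow> 'a \<Rightarrow> real) \<Rightarrow>
     source \<Rightarrow> 'a set set" where
  "source_events M w x \<epsilon> Weight = sets (vimage_algebra (space M) w borel)"
| "source_events M w x \<epsilon> (Input k) = sets (vimage_algebra (space M) (x k) borel)"
| "source_events M w x \<epsilon> (Noise k) = sets (vimage_algebra (space M) (\<epsilon> k) borel)"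

(* s2 is the noise variance, y the outputs, u the updates and what the estimates of the
   learning machine. *)
locale online_learning = prob_space M for M :: "'a measure" +
  fixes w :: "'a \<Rightarrow> real^'d"
    and x :: "nat \<Rightarrow> 'a \<Rightarrow> real^'d"
    and \<epsilon> :: "nat \<Rightarrow> 'a \<Rightarrow> real"
    and y :: "nat \<Rightarrow> 'a \<Rightarrow> real"
    and u :: "nat \<Rightarrow> 'a \<Rightarrow> real^'d"
    and what :: "nat \<Rightarrow> 'a \<Rightarrow> real^'d"
    and Sw Q :: "real^'d^'d"
    and s2 :: real
  assumes independent: "indep_sets (source_events M w x \<epsilon>) UNIV"
    and w_gaussian: "gaussian_vector M w"
    and w_mean: "has_bochner_integral M w 0"
    and w_cov: "cov_matrix M w = Sw"
    and eps_gaussian: "\<And>k. gaussian_rv M (\<epsilon> k)"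
    and eps_mean: "\<And>k. has_bochner_integral M (\<epsilon> k) 0"
    and eps_var: "\<And>k. variance (\<epsilon> k) = s2"
    and s2_pos: "0 < s2"
    and x_mean: "\<And>k. has_bochner_integral M (x k) 0"
    and x_ident: "\<And>k. distr M borel (x k) = distr M borel (x 0)"
    and x_bounded: "\<And>k. bounded (measure_support (distr M borel (x k)))"
    and x_second_moment: "\<And>k. (\<integral>\<omega>. outer (x k \<omega>) (x k \<omega>) \<partial>M) = Q"
    and Q_pos_def: "positive_definite Q"
    and y_output: "\<And>k \<omega>. \<omega> \<in> space M \<Longrightarrow> y k \<omega> = w \<omega> \<bullet> x k \<omega> + \<epsilon> k \<omega>"
    and u_update: "\<And>k. \<exists>f \<in> borel_measurable (info_space k).
                        \<forall>\<omega>\<in>space M. u k \<omega> = f (info x y u k \<omega>)"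
    and estimate_0: "\<And>\<omega>. \<omega> \<in> space M \<Longrightarrow> what 0 \<omega> = 0"
    and estimate_Suc: "\<And>k \<omega>. \<omega> \<in> space M \<Longrightarrow> what (Suc k) \<omega> = what k \<omega> + u k \<omega>"

(* The conditional expectation of w given I_k, taken componentwise. *)
definition kalman_estimate ::
  "'a measure \<Rightarrow> ('a \<Rightarrow> real^'d) \<Rightarrow> (nat \<Rightarrow> 'a \<Rightarrow> real^'d) \<Rightarrow> (nat \<Rightarrow> 'a \<Rightarrow> real) \<Rightarrow>
     (nat \<Rightarrow> 'a \<Rightarrow> real^'d) \<Rightarrow> nat \<Rightarrow> 'a \<Rightarrow> real^'d" where
  "kalman_estimate M w x y u k \<omega> =
     (\<chi> i. real_cond_exp M (vimage_algebra (space M) (info x y u k) (info_space k))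
             (\<lambda>\<omega>'. w \<omega>' $ i) \<omega>)"

definition kalman_mse ::
  "'a measure \<Rightarrow> ('a \<Rightarrow> real^'d) \<Rightarrow> (nat \<Rightarrow> 'a \<Rightarrow> real^'d) \<Rightarrow> (nat \<Rightarrow> 'a \<Rightarrow> real) \<Rightarrow>
     (nat \<Rightarrow> 'a \<Rightarrow> real^'d) \<Rightarrow> nat \<Rightarrow> real" where
  "kalman_mse M w x y u k =
     (\<integral>\<omega>. (w \<omega> - kalman_estimate M w x y u k \<omega>) \<bullet> (w \<omega> - kalman_estimate M w x y u k \<omega>) \<partial>M)"

definition cov_update :: "real \<Rightarrow> real^'d^1 \<Rightarrow> real^'d^'d \<Rightarrow> real^'d^'d" where
  "cov_update s2 C S =
     S - S ** transpose C ** matrix_inv (C ** S ** transpose C + mat s2) ** C ** S"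

(* The conditional covariance of the error at time k, given by its recursion; its value at time -1
   is Sw. *)
fun cond_cov :: "real^'d^'d \<Rightarrow> real \<Rightarrow> (nat \<Rightarrow> 'a \<Rightarrow> real^'d) \<Rightarrow> nat \<Rightarrow> 'a \<Rightarrow> real^'d^'d" where
  "cond_cov Sw s2 x 0 \<omega> = cov_update s2 (rowvector (x 0 \<omega>)) Sw"
| "cond_cov Sw s2 x (Suc k) \<omega> =
     cov_update s2 (rowvector (x (Suc k) \<omega>)) (cond_cov Sw s2 x k \<omega>)"

definition kalman_gain ::
  "real^'d^'d \<Rightarrow> real \<Rightarrow> (nat \<Rightarrow> 'a \<Rightarrow> real^'d) \<Rightarrow> nat \<Rightarrow> 'a \<Rightarrow> real^1^'d" where
  "kalman_gain Sw s2 x k \<omega> =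
     cond_cov Sw s2 x k \<omega> ** transpose (rowvector (x k \<omega>)) ** matrix_inv (mat s2)"

definition input_bound ::
  "'a measure \<Rightarrow> real^'d^'d \<Rightarrow> (nat \<Rightarrow> 'a \<Rightarrow> real^'d) \<Rightarrow> real \<Rightarrow> bool" where
  "input_bound M Sw x c \<longleftrightarrow>
     0 < c \<and>
     (\<forall>k. AE \<omega> in M.
        ((rowvector (x (Suc k) \<omega>) :: real^'d^1) ** Sw
           ** transpose (rowvector (x (Suc k) \<omega>) :: real^'d^1)) $ 1 $ 1 \<le> c)"

end

theory Submission
  imports Defs
begin

text \<open>
For a fixed input sequence the error of the Kalman recursion is a linear combination of the
independent Gaussian variables \<open>w\<close> and \<open>\<epsilon>\<^sub>j\<close>, and an induction over time shows that it is
uncorrelated with the outputs seen so far and has covariance \<open>\<Sigma>\<^sub>k\<close>. For Gaussian variables this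
makes the product of the error with \<open>exp (\<i> \<Sum> b\<^sub>j y\<^sub>j)\<close> have mean zero for all \<open>b\<close>. Integrating
over the inputs, which are independent of \<open>w\<close> and the noises, and using uniqueness of characteristic
functions, the error is orthogonal to every event of the information algebra, so that the recursion
computes the conditional expectation; this is (i).

For (ii), the trace of the covariance decreases at each step by
\<open>\<bar>\<Sigma>\<^sub>k x\<^sub>k\<^sub>+\<^sub>1\<bar>\<^sup>2 / (x\<^sub>k\<^sub>+\<^sub>1' \<Sigma>\<^sub>k x\<^sub>k\<^sub>+\<^sub>1 + \<sigma>\<^sup>2)\<close>. As \<open>x\<^sub>k\<^sub>+\<^sub>1\<close> is independent of \<open>\<Sigma>\<^sub>k\<close>, the mean decrement is at
least \<open>\<kappa> t\<^sub>k\<^sup>2\<close> with \<open>\<kappa> = \<lambda>\<^sub>m\<^sub>i\<^sub>n / (d (c\<^sub>1 + \<sigma>\<^sup>2))\<close>, where \<open>t\<^sub>k\<close> is the mean trace, and summation gives the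
rate. The entries of the gain are bounded by a constant multiple of the trace, whence (iii), and
(iv) by Markov's inequality.
\<close>

section \<open>Covariance matrices and the Kalman recursion\<close>

text \<open>With random inputs the gains are random and the error need not be Gaussian, so
  orthogonality to the outputs cannot be turned directly into independence. Freezing the input path
  makes the gains constants and puts outputs and error into one linear space of Gaussian variables.
  Only one-dimensional characteristic functions then occur, and \<open>Sw\<close> may be singular
  because no density of \<open>w\<close> and no inverse of a covariance matrix is used. The constant
  \<kappa> collects three losses. The mean of (v' x)^2 is at least \<open>lambda_min Q\<close> times
  the squared norm of v, applied to the rows of the covariance; 1/d compares the sum of the squared
  row norms with the squared trace; \<open>c1 + s2\<close> bounds the innovation variance, since the
  covariance never exceeds \<open>Sw\<close>. Nonnegativity of a variance then passes from the mean
  of the squared trace to the square of the mean trace.\<close>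

definition psd :: "real^'d^'d \<Rightarrow> bool" where
  "psd A \<longleftrightarrow> transpose A = A \<and> (\<forall>a. 0 \<le> a \<bullet> (A *v a))"

lemma symmetric_inner:
  fixes A :: "real^'d^'d"
  assumes "transpose A = A"
  shows "a \<bullet> (A *v b) = b \<bullet> (A *v a)"
  by (metis assms dot_lmul_matrix inner_commute vector_transpose_matrix)

lemma quadratic_form_add:
  fixes A :: "real^'d^'d"
  assumes "transpose A = A"
  shows "(a + t *\<^sub>R b) \<bullet> (A *v (a + t *\<^sub>R b))
           = a \<bullet> (A *v a) + 2 * t * (a \<bullet> (A *v b)) + t\<^sup>2 * (b \<bullet> (A *v b))"
  using symmetric_inner[OF assms, of a b]
  by (simp add: matrix_vector_right_distrib matrix_vector_mult_scaleR inner_add_left inner_add_right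
      algebra_simps power2_eq_square)

text \<open>The form may be degenerate. Along the line \<open>a + t b\<close> it is a nonnegative
  polynomial in t of degree at most two, so its discriminant is not positive; if the leading
  coefficient vanishes, the linear one must vanish too.\<close>

lemma psd_Cauchy_Schwarz:
  fixes A :: "real^'d^'d"
  assumes "psd A"
  shows "(a \<bullet> (A *v b))\<^sup>2 \<le> (a \<bullet> (A *v a)) * (b \<bullet> (A *v b))"
proof -
  define p q r where "p = b \<bullet> (A *v b)" and "q = a \<bullet> (A *v b)" and "r = a \<bullet> (A *v a)"
  have sym: "transpose A = A" and nonneg: "\<And>v. 0 \<le> v \<bullet> (A *v v)"
    using assms by (auto simp: psd_def)
  have pos: "0 \<le> r + 2 * t * q + t\<^sup>2 * p" for t
    using nonneg[of "a + t *\<^sub>R b"] quadratic_form_add[OF sym, of a t b]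
    by (simp add: p_def q_def r_def)
  have "p \<ge> 0" using nonneg by (simp add: p_def)
  show ?thesis
  proof (cases "p = 0")
    case True
    have "q = 0"
    proof (rule ccontr)
      assume "q \<noteq> 0"
      \<comment> \<open>At this t the remaining affine function takes the value -1.\<close>
      then show False using pos[of "- (r + 1) / (2 * q)"] True by (simp add: field_simps)
    qed
    with True show ?thesis by (simp add: p_def q_def)
  next
    case False
    with \<open>p \<ge> 0\<close> have "p > 0" by simp
    \<comment> \<open>The polynomial is evaluated at its minimiser.\<close>
    then have "0 \<le> r - q\<^sup>2 / p"
      using pos[of "- q / p"] by (simp add: field_simps power2_eq_square)
    with \<open>p > 0\<close> have "q\<^sup>2 \<le> r * p" by (simp add: field_simps)
    then show ?thesis by (simp add: p_def q_def r_def)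
  qed
qed

text \<open>Tested against \<open>A *v v\<close> itself, Cauchy-Schwarz bounds the fourth power of
  the norm of \<open>A *v v\<close> by a multiple of v' A v.\<close>

lemma psd_mult_eq_0:
  fixes A :: "real^'d^'d"
  assumes "psd A" "v \<bullet> (A *v v) = 0"
  shows "A *v v = 0"
  using psd_Cauchy_Schwarz[OF assms(1), of "A *v v" v] assms(2) by simp

lemma inner_axis_mult: "axis i (1::real) \<bullet> (A *v axis j 1) = (A :: real^'d^'d) $ i $ j"
  by (simp add: inner_axis' matrix_vector_mult_basis column_def)

lemma psd_entry_sym:
  assumes "psd A"
  shows "A $ i $ j = A $ j $ i"
proof -
  have "transpose A $ i $ j = A $ i $ j" using assms by (simp add: psd_def)
  then show ?thesis by (simp add: transpose_def)
qed

lemma psd_diag_nonneg: "psd A \<Longrightarrow> 0 \<le> A $ i $ i"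
  using inner_axis_mult[of i A i] by (auto simp: psd_def dest!: spec[of _ "axis i 1"])

lemma psd_diag_le_trace:
  fixes A :: "real^'d^'d"
  assumes "psd A"
  shows "A $ i $ i \<le> trace A"
  unfolding trace_def by (rule member_le_sum) (auto simp: psd_diag_nonneg[OF assms])

lemma psd_trace_nonneg: "psd A \<Longrightarrow> 0 \<le> trace A"
  unfolding trace_def by (intro sum_nonneg psd_diag_nonneg)

text \<open>Cauchy-Schwarz at basis vectors bounds the square of an entry by the product of two
  diagonal entries. Entrywise bounds on the covariance and the gain are all reduced to the trace in
  this way.\<close>

lemma psd_entry_le_trace:
  fixes A :: "real^'d^'d"
  assumes "psd A"
  shows "\<bar>A $ i $ j\<bar> \<le> trace A"
proof -
  have "(A $ i $ j)\<^sup>2 \<le> A $ i $ i * A $ j $ j"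
    using psd_Cauchy_Schwarz[OF assms, of "axis i 1" "axis j 1"] by (simp add: inner_axis_mult)
  also have "\<dots> \<le> trace A * trace A"
    by (intro mult_mono psd_diag_le_trace psd_trace_nonneg psd_diag_nonneg assms)
  finally show ?thesis
    using psd_trace_nonneg[OF assms] by (metis abs_le_square_iff abs_of_nonneg power2_eq_square)
qed

text \<open>The factor 1/d of the rate arises here: Cauchy-Schwarz for the diagonal against the
  constant vector, after which the squared off-diagonal entries are added.\<close>

lemma trace_square_bound:
  fixes A :: "real^'d^'d"
  shows "(trace A)\<^sup>2 / real CARD('d) \<le> (\<Sum>h\<in>UNIV. A $ h \<bullet> A $ h)"
proof -
  have "(trace A)\<^sup>2 \<le> real CARD('d) * (\<Sum>h\<in>UNIV. (A $ h $ h)\<^sup>2)"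
    using Cauchy_Schwarz_ineq_sum[of "\<lambda>_. 1" "\<lambda>h. A $ h $ h" UNIV] by (simp add: trace_def)
  also have "(\<Sum>h\<in>UNIV. (A $ h $ h)\<^sup>2) \<le> (\<Sum>h\<in>UNIV. A $ h \<bullet> A $ h)"
    unfolding inner_vec_def
    by (intro sum_mono) (auto simp: power2_eq_square intro!: member_le_sum)
  finally show ?thesis by (simp add: field_simps)
qed

section \<open>The smallest eigenvalue\<close>

lemma mat_eq_scaleR: "(mat l :: real^'d^'d) = l *\<^sub>R mat 1"
  by (simp add: vec_eq_iff mat_def)

text \<open>The minimum of the Rayleigh quotient is attained on the unit sphere, and by
  the Cauchy-Schwarz inequality for the shifted form a minimiser is an eigenvector.\<close>
lemma symmetric_min_eigenvalue:
  fixes A :: "real^'d^'d"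
  assumes sym: "transpose A = A"
  obtains l v where "v \<noteq> 0" "A *v v = l *\<^sub>R v" "\<And>a. l * (a \<bullet> a) \<le> a \<bullet> (A *v a)"
proof -
  have "continuous_on (sphere 0 1) (\<lambda>v::real^'d. v \<bullet> (A *v v))"
    by (intro continuous_intros)
  moreover have "sphere 0 1 \<noteq> ({} :: (real^'d) set)" by simp
  ultimately obtain v where v: "v \<in> sphere 0 1"
      and min: "\<And>a. a \<in> sphere 0 1 \<Longrightarrow> v \<bullet> (A *v v) \<le> a \<bullet> (A *v a)"
    using continuous_attains_inf[of "sphere (0::real^'d) 1" "\<lambda>v. v \<bullet> (A *v v)"] by auto
  define l where "l = v \<bullet> (A *v v)"
  have "norm v = 1" using v by simp
  have bound: "l * (a \<bullet> a) \<le> a \<bullet> (A *v a)" for a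
  proof (cases "a = 0")
    case False
    define b where "b = a /\<^sub>R norm a"
    have "b \<in> sphere 0 1" using False by (simp add: b_def)
    then have "l \<le> b \<bullet> (A *v b)" using min by (simp add: l_def)
    moreover have "a = norm a *\<^sub>R b" using False by (simp add: b_def)
    then have "a \<bullet> (A *v a) = (norm a)\<^sup>2 * (b \<bullet> (A *v b))"
      by (metis inner_scaleR_left inner_scaleR_right matrix_vector_mult_scaleR mult.assoc power2_eq_square)
    ultimately show ?thesis
      by (simp add: dot_square_norm mult.commute[of l] mult_left_mono)
  qed simp
  let ?B = "A - mat l"
  have B: "?B *v a = A *v a - l *\<^sub>R a" for a
    by (simp only: matrix_vector_mult_diff_rdistrib mat_eq_scaleR[of l] scaleR_matrix_vector_assoc[symmetric] matrix_vector_mul_lid)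
  have "psd ?B"
    unfolding psd_def
  proof (intro conjI allI)
    show "transpose ?B = ?B"
      using sym by (auto simp: transpose_def mat_def vec_eq_iff)
    show "0 \<le> a \<bullet> (?B *v a)" for a
      using bound[of a] by (simp add: B inner_diff_right)
  qed
  moreover have "v \<bullet> (?B *v v) = 0"
    unfolding B using \<open>norm v = 1\<close> by (simp add: inner_diff_right l_def dot_square_norm)
  ultimately have "?B *v v = 0" by (rule psd_mult_eq_0)
  then have "A *v v = l *\<^sub>R v" by (simp add: B)
  moreover have "v \<noteq> 0" using \<open>norm v = 1\<close> by auto
  ultimately show thesis using bound that by blast
qed

text \<open>\<open>LEAST\<close> on the reals determines a value only if a minimum exists; the
  minimum of the Rayleigh quotient is an eigenvalue lying below every other one.\<close>

lemma
  fixes A :: "real^'d^'d"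
  assumes "positive_definite A"
  shows lambda_min_pos: "0 < lambda_min A"
    and lambda_min_le: "lambda_min A * (a \<bullet> a) \<le> a \<bullet> (A *v a)"
proof -
  obtain l v where l: "v \<noteq> 0" "A *v v = l *\<^sub>R v" "\<And>a. l * (a \<bullet> a) \<le> a \<bullet> (A *v a)"
    using assms symmetric_min_eigenvalue unfolding positive_definite_def by metis
  have eq: "lambda_min A = l"
    unfolding lambda_min_def
  proof (rule Least_equality)
    show "\<exists>v. v \<noteq> 0 \<and> A *v v = l *\<^sub>R v" using l by blast
  next
    fix m assume "\<exists>v. v \<noteq> 0 \<and> A *v v = m *\<^sub>R v"
    then obtain b where b: "b \<noteq> 0" "A *v b = m *\<^sub>R b" by blast
    then have "0 < b \<bullet> b" by simp
    with l(3)[of b] b show "l \<le> m" by simp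
  qed
  have "0 < v \<bullet> (A *v v)" using assms l(1) by (simp add: positive_definite_def)
  then show "0 < lambda_min A"
    using l(1,2) eq by (auto simp: zero_less_mult_iff dest: less_le_trans[OF _ inner_ge_zero])
  show "lambda_min A * (a \<bullet> a) \<le> a \<bullet> (A *v a)" using l(3) eq by simp
qed

section \<open>The covariance update as a rank-one correction\<close>

lemma matrix_inv_mat_1:
  fixes r :: real
  assumes "r \<noteq> 0"
  shows "matrix_inv (mat r :: real^1^1) = mat (1 / r)"
proof -
  have *: "(mat r :: real^1^1) ** mat (1 / r) = mat 1" "(mat (1 / r) :: real^1^1) ** mat r = mat 1"
    using assms by (simp_all add: vec_eq_iff matrix_matrix_mult_def mat_def)
  \<comment> \<open>\<open>matrix_inv\<close> is defined by choice: existence of an inverse makes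
    the chosen matrix an inverse, and uniqueness of inverses then identifies it.\<close>
  then have "(mat r :: real^1^1) ** matrix_inv (mat r) = mat 1"
    unfolding matrix_inv_def by (metis (mono_tags, lifting) someI_ex)
  then show ?thesis
    using * by (metis matrix_mul_assoc matrix_mul_lid matrix_mul_rid)
qed

text \<open>The matrix to be inverted is the innovation variance, a positive 1x1 matrix, so
  inversion is division by a scalar.\<close>

lemma cov_update_entry:
  fixes S :: "real^'d^'d"
  assumes S: "psd S" and s2: "0 < s2"
  shows "cov_update s2 (rowvector c) S $ i $ j
           = S $ i $ j - (S *v c) $ i * (S *v c) $ j / (c \<bullet> (S *v c) + s2)"
proof -
  let ?C = "rowvector c :: real^'d^1"
  have r: "c \<bullet> (S *v c) + s2 > 0" using S s2 by (simp add: psd_def add_nonneg_pos)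
  have 1: "(S ** transpose ?C) $ a $ b = (S *v c) $ a" for a b
    by (simp add: matrix_matrix_mult_def matrix_vector_mult_def transpose_def rowvector_def)
  have 2: "(?C ** S) $ a $ b = (S *v c) $ b" for a b
    using psd_entry_sym[OF S] by (simp add: matrix_matrix_mult_def matrix_vector_mult_def rowvector_def mult.commute)
  have 3: "?C ** S ** transpose ?C + mat s2 = mat (c \<bullet> (S *v c) + s2)"
    by (simp add: vec_eq_iff mat_def matrix_mul_assoc[symmetric])
      (simp add: matrix_matrix_mult_def[of "rowvector c :: real^'d^1"] 1, simp add: inner_vec_def rowvector_def)
  have "S ** transpose ?C ** matrix_inv (?C ** S ** transpose ?C + mat s2) ** ?C ** S
      = (S ** transpose ?C) ** mat (1 / (c \<bullet> (S *v c) + s2)) ** (?C ** S)"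
    unfolding 3 using r by (subst matrix_inv_mat_1) (simp_all add: matrix_mul_assoc)
  moreover have 4: "(S ** transpose ?C ** mat t) $ i $ k = (S *v c) $ i * t" for t and k :: 1
    unfolding matrix_matrix_mult_def[of _ "mat t"] by (simp add: 1) (simp add: mat_def)
  have "(S ** transpose ?C ** mat t ** (?C ** S)) $ i $ j = (S *v c) $ i * t * (S *v c) $ j" for t
    unfolding matrix_matrix_mult_def[of _ "?C ** S"] by (simp add: 2 4)
  ultimately show ?thesis by (simp add: cov_update_def)
qed

lemma cov_update_form:
  fixes S :: "real^'d^'d"
  assumes S: "psd S" and s2: "0 < s2"
  shows "a \<bullet> (cov_update s2 (rowvector c) S *v b)
           = a \<bullet> (S *v b) - (a \<bullet> (S *v c)) * (b \<bullet> (S *v c)) / (c \<bullet> (S *v c) + s2)"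
proof -
  let ?r = "c \<bullet> (S *v c) + s2"
  have "cov_update s2 (rowvector c) S *v b = S *v b - ((b \<bullet> (S *v c)) / ?r) *\<^sub>R (S *v c)"
    by (simp add: vec_eq_iff)
      (simp add: matrix_vector_mult_def[of "cov_update _ _ _"] matrix_vector_mult_def[of S b] cov_update_entry[OF S s2]
        inner_vec_def[of b] sum_distrib_left sum_distrib_right sum_subtractf sum_divide_distrib algebra_simps)
  then show ?thesis by (simp add: inner_diff_right)
qed

text \<open>Cauchy-Schwarz for the form of \<open>S\<close> keeps the subtracted quotient below the
  old value of the form. \<open>S\<close> is nowhere inverted, so singular covariances are
  covered.\<close>

lemma psd_cov_update:
  fixes S :: "real^'d^'d"
  assumes S: "psd S" and s2: "0 < s2"
  shows "psd (cov_update s2 (rowvector c) S)"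
  unfolding psd_def
proof (intro conjI allI)
  show "transpose (cov_update s2 (rowvector c) S) = cov_update s2 (rowvector c) S"
    by (simp add: transpose_def vec_eq_iff cov_update_entry[OF S s2] psd_entry_sym[OF S] mult.commute)
  fix a
  have r: "c \<bullet> (S *v c) + s2 > 0" using S s2 by (simp add: psd_def add_nonneg_pos)
  have "(a \<bullet> (S *v c))\<^sup>2 \<le> (a \<bullet> (S *v a)) * (c \<bullet> (S *v c) + s2)"
    using psd_Cauchy_Schwarz[OF S, of a c] S s2 by (simp add: distrib_left psd_def add_increasing2)
  with r show "0 \<le> a \<bullet> (cov_update s2 (rowvector c) S *v a)"
    by (simp add: cov_update_form[OF S s2] field_simps power2_eq_square)
qed

section \<open>The recursion along a fixed input sequence\<close>

text \<open>Time is shifted by one: \<open>error_cov Sw s2 c n\<close> is \<open>\<Sigma>\<close> at time \<open>n - 1\<close> for the inputs \<open>c\<close>, and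
  \<open>estimate Sw s2 c z n\<close> is the Kalman estimate from the \<open>n\<close> outputs \<open>z 0, ..., z (n - 1)\<close>.\<close>
primrec error_cov :: "real^'d^'d \<Rightarrow> real \<Rightarrow> (nat \<Rightarrow> real^'d) \<Rightarrow> nat \<Rightarrow> real^'d^'d" where
  "error_cov Sw s2 c 0 = Sw"
| "error_cov Sw s2 c (Suc n) = cov_update s2 (rowvector (c n)) (error_cov Sw s2 c n)"

primrec estimate :: "real^'d^'d \<Rightarrow> real \<Rightarrow> (nat \<Rightarrow> real^'d) \<Rightarrow> (nat \<Rightarrow> real) \<Rightarrow> nat \<Rightarrow> real^'d" where
  "estimate Sw s2 c z 0 = 0"
| "estimate Sw s2 c z (Suc n) = estimate Sw s2 c z n
     + ((z n - estimate Sw s2 c z n \<bullet> c n) / (c n \<bullet> (error_cov Sw s2 c n *v c n) + s2))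
         *\<^sub>R (error_cov Sw s2 c n *v c n)"

lemma borel_measurable_vec_nth:
  fixes f :: "'b \<Rightarrow> 'c::euclidean_space^'n"
  assumes "f \<in> borel_measurable N"
  shows "(\<lambda>\<omega>. f \<omega> $ i) \<in> borel_measurable N"
  using assms by (rule borel_measurable_continuous_on[rotated]) (intro continuous_intros)

lemma borel_measurable_vec_iff:
  fixes f :: "'b \<Rightarrow> 'c::euclidean_space^'n"
  shows "f \<in> borel_measurable N \<longleftrightarrow> (\<forall>i. (\<lambda>\<omega>. f \<omega> $ i) \<in> borel_measurable N)"
proof (intro iffI allI)
  assume *: "\<forall>i. (\<lambda>\<omega>. f \<omega> $ i) \<in> borel_measurable N"
  show "f \<in> borel_measurable N"
    unfolding borel_measurable_euclidean_space[of f]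
  proof
    fix b :: "'c^'n" assume "b \<in> Basis"
    then obtain i e where "b = axis i e" by (auto simp: Basis_vec_def)
    then show "(\<lambda>\<omega>. f \<omega> \<bullet> b) \<in> borel_measurable N"
      using *[rule_format, of i] by (simp add: inner_axis)
  qed
qed (rule borel_measurable_vec_nth)

lemma cond_cov_eq: "cond_cov Sw s2 x k \<omega> = error_cov Sw s2 (\<lambda>j. x j \<omega>) (Suc k)"
  by (induction k) auto

context
  fixes Sw :: "real^'d^'d" and s2 :: real
  assumes Sw: "psd Sw" and s2: "0 < s2"
begin

lemma psd_error_cov: "psd (error_cov Sw s2 c n)"
  by (induction n) (simp_all add: Sw psd_cov_update s2)

lemma error_cov_denominator_pos: "0 < c \<bullet> (error_cov Sw s2 c' n *v c) + s2"
  using psd_error_cov[of c' n] s2 by (simp add: psd_def add_nonneg_pos)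

lemma error_cov_form_Suc:
  "a \<bullet> (error_cov Sw s2 c (Suc n) *v b) = a \<bullet> (error_cov Sw s2 c n *v b)
     - (a \<bullet> (error_cov Sw s2 c n *v c n)) * (b \<bullet> (error_cov Sw s2 c n *v c n))
         / (c n \<bullet> (error_cov Sw s2 c n *v c n) + s2)"
  by (simp add: cov_update_form psd_error_cov s2)

text \<open>Every update subtracts a square over a positive number. Hence a bound on x'
  \<open>Sw\<close> x controls the innovation variance at all later times.\<close>

lemma error_cov_form_le: "a \<bullet> (error_cov Sw s2 c n *v a) \<le> a \<bullet> (Sw *v a)"
proof (induction n)
  case (Suc n)
  have "a \<bullet> (error_cov Sw s2 c (Suc n) *v a) \<le> a \<bullet> (error_cov Sw s2 c n *v a)"
    unfolding error_cov_form_Suc using error_cov_denominator_pos[of "c n" c n] by simp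
  then show ?case using Suc by linarith
qed simp

lemma trace_error_cov_le: "trace (error_cov Sw s2 c n) \<le> trace Sw"
  unfolding trace_def
  using error_cov_form_le[of "axis _ 1" c n] by (auto simp: inner_axis_mult intro!: sum_mono)

text \<open>The sum is the squared norm of the covariance applied to \<open>c n\<close>. Written by
  rows, it can be averaged over the next input term by term.\<close>

lemma trace_error_cov_Suc:
  "trace (error_cov Sw s2 c (Suc n)) = trace (error_cov Sw s2 c n)
     - (\<Sum>h\<in>UNIV. (error_cov Sw s2 c n $ h \<bullet> c n)\<^sup>2) / (c n \<bullet> (error_cov Sw s2 c n *v c n) + s2)"
proof -
  have "error_cov Sw s2 c (Suc n) $ i $ i = error_cov Sw s2 c n $ i $ i
      - (error_cov Sw s2 c n $ i \<bullet> c n)\<^sup>2 / (c n \<bullet> (error_cov Sw s2 c n *v c n) + s2)" for i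
    using error_cov_form_Suc[of "axis i 1" c n "axis i 1"]
    unfolding inner_axis_mult
    by (simp add: inner_axis' matrix_vector_mul_component[of _ "c n"] power2_eq_square del: error_cov.simps)
  then show ?thesis
    by (simp add: trace_def sum_subtractf sum_divide_distrib del: error_cov.simps)
qed

lemma measurable_error_cov:
  assumes "\<And>j. j < n \<Longrightarrow> c j \<in> borel_measurable N"
  shows "(\<lambda>\<omega>. error_cov Sw s2 (\<lambda>j. c j \<omega>) n) \<in> borel_measurable N"
  using assms
proof (induction n)
  case (Suc n)
  define S where "S = (\<lambda>\<omega>. error_cov Sw s2 (\<lambda>j. c j \<omega>) n)"
  have [measurable]: "c n \<in> borel_measurable N" by (simp add: Suc.prems)
  have "S \<in> borel_measurable N" using Suc by (simp add: S_def)
  then have [measurable]: "(\<lambda>\<omega>. S \<omega> $ i) \<in> borel_measurable N"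
      "(\<lambda>\<omega>. S \<omega> $ i $ j) \<in> borel_measurable N" for i j
    by (simp_all add: borel_measurable_vec_nth)
  have [measurable]: "(\<lambda>\<omega>. c n \<omega> $ i) \<in> borel_measurable N" for i
    by (simp add: borel_measurable_vec_nth)
  have "error_cov Sw s2 (\<lambda>j. c j \<omega>) (Suc n) $ i $ j = S \<omega> $ i $ j - (S \<omega> $ i \<bullet> c n \<omega>)
      * (S \<omega> $ j \<bullet> c n \<omega>) / ((\<Sum>h\<in>UNIV. c n \<omega> $ h * (S \<omega> $ h \<bullet> c n \<omega>)) + s2)" for \<omega> i j
    by (simp add: cov_update_entry psd_error_cov s2 matrix_vector_mul_component S_def inner_vec_def[of "c n \<omega>"])
  moreover have "(\<lambda>\<omega>. S \<omega> $ i $ j - (S \<omega> $ i \<bullet> c n \<omega>)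
      * (S \<omega> $ j \<bullet> c n \<omega>) / ((\<Sum>h\<in>UNIV. c n \<omega> $ h * (S \<omega> $ h \<bullet> c n \<omega>)) + s2))
      \<in> borel_measurable N" for i j
    by measurable
  ultimately show ?case
    by (simp add: borel_measurable_vec_iff del: error_cov.simps)
qed simp

text \<open>The hypotheses stop at \<open>j < n\<close> because the lemma is applied to the
  information algebra, where only data up to the current time are known to be measurable.\<close>

lemma measurable_estimate:
  assumes "\<And>j. j < n \<Longrightarrow> c j \<in> borel_measurable N"
    and "\<And>j. j < n \<Longrightarrow> z j \<in> borel_measurable N"
  shows "(\<lambda>\<omega>. estimate Sw s2 (\<lambda>j. c j \<omega>) (\<lambda>j. z j \<omega>) n) \<in> borel_measurable N"
  using assms
proof (induction n)
  case (Suc n)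
  define S where "S = (\<lambda>\<omega>. error_cov Sw s2 (\<lambda>j. c j \<omega>) n)"
  define m where "m = (\<lambda>\<omega>. estimate Sw s2 (\<lambda>j. c j \<omega>) (\<lambda>j. z j \<omega>) n)"
  have [measurable]: "c n \<in> borel_measurable N" "z n \<in> borel_measurable N"
    by (simp_all add: Suc.prems)
  have [measurable]: "m \<in> borel_measurable N" using Suc by (simp add: m_def)
  have "S \<in> borel_measurable N" using Suc by (simp add: S_def measurable_error_cov)
  then have [measurable]: "(\<lambda>\<omega>. S \<omega> $ i) \<in> borel_measurable N" for i
    by (simp add: borel_measurable_vec_nth)
  have "(\<lambda>\<omega>. (S \<omega> *v c n \<omega>) $ i) \<in> borel_measurable N" for i
    unfolding matrix_vector_mul_component by measurable
  then have [measurable]: "(\<lambda>\<omega>. S \<omega> *v c n \<omega>) \<in> borel_measurable N"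
    by (simp add: borel_measurable_vec_iff)
  have "(\<lambda>\<omega>. m \<omega> + ((z n \<omega> - m \<omega> \<bullet> c n \<omega>) / (c n \<omega> \<bullet> (S \<omega> *v c n \<omega>) + s2)) *\<^sub>R (S \<omega> *v c n \<omega>))
      \<in> borel_measurable N"
    by measurable
  then show ?case by (simp add: m_def S_def)
qed simp

end

section \<open>Uniqueness of characteristic functions for signed densities\<close>

lemma norm_iexp_mult: "norm (z * iexp t) = norm z"
  by (simp add: norm_mult)

text \<open>The positive and negative parts of \<open>Z\<close>, divided by their common mass, are
  densities of two probability measures. Their images under \<open>Y\<close> have the same
  characteristic function and therefore coincide.\<close>

lemma integral_indicator_eq_0_real:
  fixes Z Y :: "'a \<Rightarrow> real"
  assumes Z[measurable]: "integrable M Z" and Y[measurable]: "Y \<in> borel_measurable M"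
    and zero: "\<And>s. (\<integral>\<omega>. complex_of_real (Z \<omega>) * iexp (s * Y \<omega>) \<partial>M) = 0"
    and B[measurable]: "B \<in> sets borel"
  shows "(\<integral>\<omega>. Z \<omega> * indicator B (Y \<omega>) \<partial>M) = 0"
proof -
  define P N where "P = (\<lambda>\<omega>. max 0 (Z \<omega>))" and "N = (\<lambda>\<omega>. max 0 (- Z \<omega>))"
  have int: "integrable M P" "integrable M N" using Z by (auto simp: P_def N_def)
  note [measurable] = borel_measurable_integrable[OF int(1)] borel_measurable_integrable[OF int(2)]
  have nonneg: "0 \<le> P \<omega>" "0 \<le> N \<omega>" for \<omega> by (auto simp: P_def N_def)
  have Z_eq: "Z \<omega> = P \<omega> - N \<omega>" for \<omega> by (auto simp: P_def N_def)
  have inte: "integrable M (\<lambda>\<omega>. complex_of_real (P \<omega>) * iexp (s * Y \<omega>))"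
    "integrable M (\<lambda>\<omega>. complex_of_real (N \<omega>) * iexp (s * Y \<omega>))" for s
    by (rule Bochner_Integration.integrable_bound[OF int(1)]; simp add: norm_mult)
      (rule Bochner_Integration.integrable_bound[OF int(2)]; simp add: norm_mult)
  have inti: "integrable M (\<lambda>\<omega>. P \<omega> * indicator B (Y \<omega>))" "integrable M (\<lambda>\<omega>. N \<omega> * indicator B (Y \<omega>))"
    by (rule Bochner_Integration.integrable_bound[OF int(1)]; simp add: indicator_def)
      (rule Bochner_Integration.integrable_bound[OF int(2)]; simp add: indicator_def)
  have char_eq: "(\<integral>\<omega>. complex_of_real (P \<omega>) * iexp (s * Y \<omega>) \<partial>M)
      = (\<integral>\<omega>. complex_of_real (N \<omega>) * iexp (s * Y \<omega>) \<partial>M)" for s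
    using zero[of s] inte[of s] by (simp add: Z_eq left_diff_distrib)
  define p where "p = (\<integral>\<omega>. P \<omega> \<partial>M)"
  \<comment> \<open>Frequency 0 of the hypothesis says that the two parts have equal mass.\<close>
  have p_eq: "p = (\<integral>\<omega>. N \<omega> \<partial>M)"
    using char_eq[of 0] by (simp add: p_def)
  have "p \<ge> 0" unfolding p_def by (intro integral_nonneg_AE) (auto simp: nonneg)
  show ?thesis
  proof (cases "p = 0")
    \<comment> \<open>Here normalisation is impossible, but both parts vanish almost
      everywhere.\<close>
    case True
    have "AE \<omega> in M. P \<omega> = 0"
      using integral_nonneg_eq_0_iff_AE[OF int(1)] True nonneg by (simp add: p_def)
    moreover have "AE \<omega> in M. N \<omega> = 0"
      using integral_nonneg_eq_0_iff_AE[OF int(2)] True nonneg by (simp add: p_eq)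
    ultimately have "AE \<omega> in M. Z \<omega> * indicator B (Y \<omega>) = 0"
      by eventually_elim (simp add: Z_eq)
    then show ?thesis by (rule integral_eq_zero_AE)
  next
    case False
    with \<open>p \<ge> 0\<close> have "p > 0" by simp
    define \<mu> where "\<mu> = (\<lambda>f. distr (density M (\<lambda>\<omega>. ennreal (f \<omega> / p))) borel Y)"
    have *: "real_distribution (\<mu> f) \<and> char (\<mu> f) s = (\<integral>\<omega>. complex_of_real (f \<omega>) * iexp (s * Y \<omega>) \<partial>M) / p
        \<and> measure (\<mu> f) B = (\<integral>\<omega>. f \<omega> * indicator B (Y \<omega>) \<partial>M) / p"
      if f: "integrable M f" "\<And>\<omega>. 0 \<le> f \<omega>" "(\<integral>\<omega>. f \<omega> \<partial>M) = p" for f s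
    proof -
      have [measurable]: "f \<in> borel_measurable M" using f by simp
      have "(\<integral>\<^sup>+\<omega>. ennreal (f \<omega> / p) \<partial>M) = 1"
        using f \<open>p > 0\<close> by (subst nn_integral_eq_integral) auto
      then have "prob_space (density M (\<lambda>\<omega>. ennreal (f \<omega> / p)))"
        by (intro prob_spaceI) (simp add: emeasure_density cong: nn_integral_cong)
      then have 1: "real_distribution (\<mu> f)"
        unfolding \<mu>_def by (intro prob_space.real_distribution_distr) auto
      have 2: "char (\<mu> f) s = (\<integral>\<omega>. complex_of_real (f \<omega>) * iexp (s * Y \<omega>) \<partial>M) / p"
        using f \<open>p > 0\<close> unfolding \<mu>_def char_def
        by (simp add: integral_distr integral_density scaleR_conv_of_real)
      have "measure (\<mu> f) B = (\<integral>t. indicator B t \<partial>\<mu> f)"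
        by (simp add: \<mu>_def)
      also have "\<dots> = (\<integral>\<omega>. f \<omega> * indicator B (Y \<omega>) \<partial>M) / p"
        using f \<open>p > 0\<close> unfolding \<mu>_def
        by (subst integral_distr) (auto simp: integral_density)
      finally show ?thesis using 1 2 by simp
    qed
    note P = *[OF int(1) nonneg(1) p_def[symmetric]] and N = *[OF int(2) nonneg(2) p_eq[symmetric]]
    have "\<mu> P = \<mu> N"
      using P N char_eq by (intro Levy_uniqueness) auto
    with P N \<open>p > 0\<close> have "(\<integral>\<omega>. P \<omega> * indicator B (Y \<omega>) \<partial>M) = (\<integral>\<omega>. N \<omega> * indicator B (Y \<omega>) \<partial>M)"
      by simp
    with inti show ?thesis by (simp add: Z_eq left_diff_distrib)
  qed
qed

text \<open>Real and imaginary parts are combinations of \<open>Z\<close> and its conjugate, and the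
  hypothesis for the conjugate is the conjugate of the hypothesis at frequency
  \<open>- s\<close>.\<close>

lemma integral_indicator_eq_0_complex:
  fixes Z :: "'a \<Rightarrow> complex" and Y :: "'a \<Rightarrow> real"
  assumes Z: "integrable M Z" and Y[measurable]: "Y \<in> borel_measurable M"
    and zero: "\<And>s. (\<integral>\<omega>. Z \<omega> * iexp (s * Y \<omega>) \<partial>M) = 0"
    and B[measurable]: "B \<in> sets borel"
  shows "(\<integral>\<omega>. Z \<omega> * indicator B (Y \<omega>) \<partial>M) = 0"
proof -
  note [measurable] = borel_measurable_integrable[OF Z]
  have int: "integrable M (\<lambda>\<omega>. Z \<omega> * iexp (s * Y \<omega>))" for s
    by (rule Bochner_Integration.integrable_bound[OF Z]) (auto simp: norm_mult)
  have cnj: "(\<integral>\<omega>. cnj (Z \<omega>) * iexp (s * Y \<omega>) \<partial>M) = 0" for s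
  proof -
    have "(\<integral>\<omega>. cnj (Z \<omega>) * iexp (s * Y \<omega>) \<partial>M) = (\<integral>\<omega>. cnj (Z \<omega> * iexp (- s * Y \<omega>)) \<partial>M)"
      by (simp add: exp_cnj)
    also have "\<dots> = cnj (\<integral>\<omega>. Z \<omega> * iexp (- s * Y \<omega>) \<partial>M)" by (rule Bochner_Integration.integral_cnj)
    finally show ?thesis using zero[of "- s"] by simp
  qed
  have intc: "integrable M (\<lambda>\<omega>. cnj (Z \<omega>) * iexp (s * Y \<omega>))" for s
  proof (rule Bochner_Integration.integrable_bound[OF integrable_cnj[OF Z]])
    have [measurable]: "(\<lambda>\<omega>. cnj (Z \<omega>)) \<in> borel_measurable M"
      using Z by (intro borel_measurable_integrable integrable_cnj)
    show "(\<lambda>\<omega>. cnj (Z \<omega>) * iexp (s * Y \<omega>)) \<in> borel_measurable M" by measurable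
  qed (simp add: norm_mult)
  have Re: "complex_of_real (Re z) * e = (z * e + cnj z * e) / 2"
    and Im: "complex_of_real (Im z) * e = (z * e - cnj z * e) / (2 * \<i>)" for z e
    by (simp_all add: complex_eq_iff)
  have "(\<integral>\<omega>. complex_of_real (Re (Z \<omega>)) * iexp (s * Y \<omega>) \<partial>M) = 0" for s
    unfolding Re using int[of s] intc[of s]
    by (simp only: integral_divide_zero Bochner_Integration.integral_add Bochner_Integration.integral_diff zero cnj) simp
  then have re: "(\<integral>\<omega>. Re (Z \<omega>) * indicator B (Y \<omega>) \<partial>M) = 0"
    using Z by (intro integral_indicator_eq_0_real) auto
  have "(\<integral>\<omega>. complex_of_real (Im (Z \<omega>)) * iexp (s * Y \<omega>) \<partial>M) = 0" for s
    unfolding Im using int[of s] intc[of s]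
    by (simp only: integral_divide_zero Bochner_Integration.integral_add Bochner_Integration.integral_diff zero cnj) simp
  then have im: "(\<integral>\<omega>. Im (Z \<omega>) * indicator B (Y \<omega>) \<partial>M) = 0"
    using Z by (intro integral_indicator_eq_0_real) auto
  have inti: "integrable M (\<lambda>\<omega>. Z \<omega> * indicator B (Y \<omega>))"
    by (rule Bochner_Integration.integrable_bound[OF Z]) (auto simp: indicator_def)
  show ?thesis
  proof (rule complex_eqI)
    have "Re (\<integral>\<omega>. Z \<omega> * indicator B (Y \<omega>) \<partial>M) = (\<integral>\<omega>. Re (Z \<omega>) * indicator B (Y \<omega>) \<partial>M)"
      by (subst integral_Re[OF inti, symmetric])
        (auto intro!: Bochner_Integration.integral_cong simp: indicator_def)
    with re show "Re (\<integral>\<omega>. Z \<omega> * indicator B (Y \<omega>) \<partial>M) = Re 0" by simp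
    have "Im (\<integral>\<omega>. Z \<omega> * indicator B (Y \<omega>) \<partial>M) = (\<integral>\<omega>. Im (Z \<omega>) * indicator B (Y \<omega>) \<partial>M)"
      by (subst integral_Im[OF inti, symmetric])
        (auto intro!: Bochner_Integration.integral_cong simp: indicator_def)
    with im show "Im (\<integral>\<omega>. Z \<omega> * indicator B (Y \<omega>) \<partial>M) = Im 0" by simp
  qed
qed

text \<open>The coordinates are freed one at a time; complex weights let the remaining exponentials be
  absorbed into \<open>Z\<close>, so that only one-dimensional uniqueness of characteristic functions is used.\<close>
lemma integral_prod_indicator_eq_0:
  fixes Z :: "'a \<Rightarrow> complex" and Y :: "nat \<Rightarrow> 'a \<Rightarrow> real"
  assumes Z: "integrable M Z" and Y: "\<And>j. j < n \<Longrightarrow> Y j \<in> borel_measurable M"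
    and zero: "\<And>b. (\<integral>\<omega>. Z \<omega> * iexp (\<Sum>j<n. b j * Y j \<omega>) \<partial>M) = 0"
    and B: "\<And>j. j < n \<Longrightarrow> B j \<in> sets borel"
  shows "(\<integral>\<omega>. Z \<omega> * (\<Prod>j<n. indicator (B j) (Y j \<omega>)) \<partial>M) = 0"
  using assms
proof (induction n arbitrary: Z)
  case (Suc n)
  note [measurable] = borel_measurable_integrable[OF Suc.prems(1)]
  have [measurable]: "Y n \<in> borel_measurable M" "B n \<in> sets borel" using Suc.prems by auto
  have [measurable]: "(\<lambda>\<omega>. \<Sum>j<n. b j * Y j \<omega>) \<in> borel_measurable M" for b :: "nat \<Rightarrow> real"
    using Suc.prems by (intro borel_measurable_sum borel_measurable_times) auto
  let ?Z = "\<lambda>\<omega>. Z \<omega> * indicator (B n) (Y n \<omega>)"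
  have "(\<integral>\<omega>. ?Z \<omega> * (\<Prod>j<n. indicator (B j) (Y j \<omega>)) \<partial>M) = 0"
  proof (rule Suc.IH)
    show "integrable M ?Z"
      by (rule Bochner_Integration.integrable_bound[OF Suc.prems(1)]) (auto simp: indicator_def)
    fix b :: "nat \<Rightarrow> real"
    have "(\<integral>\<omega>. (Z \<omega> * iexp (\<Sum>j<n. b j * Y j \<omega>)) * indicator (B n) (Y n \<omega>) \<partial>M) = 0"
    proof (rule integral_indicator_eq_0_complex)
      show "integrable M (\<lambda>\<omega>. Z \<omega> * iexp (\<Sum>j<n. b j * Y j \<omega>))"
        by (rule Bochner_Integration.integrable_bound[OF Suc.prems(1)])
           (simp_all add: norm_iexp_mult del: of_real_sum)
      fix s :: real
      \<comment> \<open>\<open>b(n := s)\<close> keeps the first n frequencies fixed while the last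
        one runs through all reals.\<close>
      have "(\<Sum>j<Suc n. (b(n := s)) j * Y j \<omega>) = (\<Sum>j<n. b j * Y j \<omega>) + s * Y n \<omega>" for \<omega>
        by simp
      then have "iexp (\<Sum>j<Suc n. (b(n := s)) j * Y j \<omega>) = iexp (\<Sum>j<n. b j * Y j \<omega>) * iexp (s * Y n \<omega>)" for \<omega>
        by (simp only: distrib_left exp_add of_real_add)
      then show "(\<integral>\<omega>. Z \<omega> * iexp (\<Sum>j<n. b j * Y j \<omega>) * iexp (s * Y n \<omega>) \<partial>M) = 0"
        using Suc.prems(3)[of "b(n := s)"] by (simp only: mult.assoc)
    qed simp_all
    then show "(\<integral>\<omega>. ?Z \<omega> * iexp (\<Sum>j<n. b j * Y j \<omega>) \<partial>M) = 0"
      by (simp only: mult.assoc mult.commute mult.left_commute)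
  qed (use Suc.prems in auto)
  then show ?case by (simp only: prod.lessThan_Suc mult.assoc mult.commute mult.left_commute)
qed simp

section \<open>Centred Gaussian variables\<close>

text \<open>Stated through the characteristic function, so that the degenerate law needs no separate case.\<close>
definition centred_gaussian :: "'a measure \<Rightarrow> ('a \<Rightarrow> real) \<Rightarrow> bool" where
  "centred_gaussian M X \<longleftrightarrow> X \<in> borel_measurable M \<and> integrable M (\<lambda>\<omega>. (X \<omega>)\<^sup>2)
     \<and> (\<integral>\<omega>. X \<omega> \<partial>M) = 0
     \<and> (\<forall>t. (\<integral>\<omega>. iexp (t * X \<omega>) \<partial>M) = exp (- (t\<^sup>2 * (\<integral>\<omega>. (X \<omega>)\<^sup>2 \<partial>M) / 2)))"

lemma integrable_mult_of_squares:
  fixes f g :: "'a \<Rightarrow> real"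
  assumes [measurable]: "f \<in> borel_measurable M" "g \<in> borel_measurable M"
    and sq: "integrable M (\<lambda>\<omega>. (f \<omega>)\<^sup>2)" "integrable M (\<lambda>\<omega>. (g \<omega>)\<^sup>2)"
  shows "integrable M (\<lambda>\<omega>. f \<omega> * g \<omega>)"
proof (rule Bochner_Integration.integrable_bound)
  show "integrable M (\<lambda>\<omega>. (f \<omega>)\<^sup>2 + (g \<omega>)\<^sup>2)" using sq by simp
  have "\<bar>a * b\<bar> \<le> a\<^sup>2 + b\<^sup>2" for a b :: real
    using sum_squares_bound[of "\<bar>a\<bar>" "\<bar>b\<bar>"] mult_nonneg_nonneg[OF abs_ge_zero abs_ge_zero, of a b]
    unfolding abs_mult power2_abs by linarith
  then show "AE \<omega> in M. norm (f \<omega> * g \<omega>) \<le> norm ((f \<omega>)\<^sup>2 + (g \<omega>)\<^sup>2)" by simp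
qed simp

context prob_space
begin

lemma integrable_of_square:
  fixes f :: "'a \<Rightarrow> real"
  assumes "f \<in> borel_measurable M" "integrable M (\<lambda>\<omega>. (f \<omega>)\<^sup>2)"
  shows "integrable M f"
  using integrable_mult_of_squares[OF assms(1) _ assms(2), of "\<lambda>_. 1"] by simp

lemma centred_gaussian_scale:
  assumes "centred_gaussian M X"
  shows "centred_gaussian M (\<lambda>\<omega>. r * X \<omega>)"
proof -
  have "(\<integral>\<omega>. iexp (t * (r * X \<omega>)) \<partial>M) = exp (- (t\<^sup>2 * (\<integral>\<omega>. (r * X \<omega>)\<^sup>2 \<partial>M) / 2))" for t
    using assms unfolding centred_gaussian_def
    by (simp only: mult.assoc[symmetric, of t r]) (simp add: power_mult_distrib mult.assoc)
  moreover have "X \<in> borel_measurable M" using assms by (simp add: centred_gaussian_def)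
  then have "(\<lambda>\<omega>. r * X \<omega>) \<in> borel_measurable M" by simp
  ultimately show ?thesis
    using assms unfolding centred_gaussian_def by (simp add: power_mult_distrib)
qed

lemma indep_var_integral_mult_complex:
  fixes X Y :: "'a \<Rightarrow> real" and f g :: "real \<Rightarrow> complex"
  assumes ind: "indep_var borel X borel Y"
    and [measurable]: "f \<in> borel_measurable borel" "g \<in> borel_measurable borel"
    and int: "integrable M (\<lambda>\<omega>. f (X \<omega>))" "integrable M (\<lambda>\<omega>. g (Y \<omega>))"
  shows "(\<integral>\<omega>. f (X \<omega>) * g (Y \<omega>) \<partial>M) = (\<integral>\<omega>. f (X \<omega>) \<partial>M) * (\<integral>\<omega>. g (Y \<omega>) \<partial>M)"
  using indep_var_lebesgue_integral[OF indep_var_compose[OF ind, of f borel g borel, unfolded comp_def] int]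
  by simp

text \<open>Independence enters twice: it factors the characteristic function, and it removes the
  mixed term from the variance in the exponent.\<close>

lemma centred_gaussian_add:
  assumes ind: "indep_var borel X borel Y"
    and X: "centred_gaussian M X" and Y: "centred_gaussian M Y"
  shows "centred_gaussian M (\<lambda>\<omega>. X \<omega> + Y \<omega>)"
proof -
  note Xd = X[unfolded centred_gaussian_def] and Yd = Y[unfolded centred_gaussian_def]
  have [measurable]: "X \<in> borel_measurable M" "Y \<in> borel_measurable M" using Xd Yd by auto
  have int: "integrable M X" "integrable M Y" "integrable M (\<lambda>\<omega>. X \<omega> * Y \<omega>)"
    using Xd Yd by (auto intro: integrable_of_square integrable_mult_of_squares)
  have XY: "(\<integral>\<omega>. X \<omega> * Y \<omega> \<partial>M) = 0"
    using indep_var_lebesgue_integral[OF ind int(1,2)] Xd by simp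
  have sq: "(X \<omega> + Y \<omega>)\<^sup>2 = (X \<omega>)\<^sup>2 + (Y \<omega>)\<^sup>2 + 2 * (X \<omega> * Y \<omega>)" for \<omega>
    by (simp add: power2_sum)
  have "(\<integral>\<omega>. iexp (t * (X \<omega> + Y \<omega>)) \<partial>M)
      = exp (- (t\<^sup>2 * (\<integral>\<omega>. (X \<omega> + Y \<omega>)\<^sup>2 \<partial>M) / 2))" for t
  proof -
    have "iexp (t * (a + b)) = iexp (t * a) * iexp (t * b)" for a b
      by (simp only: distrib_left exp_add of_real_add)
    then have "(\<integral>\<omega>. iexp (t * (X \<omega> + Y \<omega>)) \<partial>M) = (\<integral>\<omega>. iexp (t * X \<omega>) * iexp (t * Y \<omega>) \<partial>M)"
      by simp
    also have "\<dots> = (\<integral>\<omega>. iexp (t * X \<omega>) \<partial>M) * (\<integral>\<omega>. iexp (t * Y \<omega>) \<partial>M)"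
      by (rule indep_var_integral_mult_complex[OF ind])
        (auto intro!: integrable_const_bound[where B = 1])
    also have "\<dots> = exp (- (t\<^sup>2 * (\<integral>\<omega>. (X \<omega>)\<^sup>2 \<partial>M) / 2) + - (t\<^sup>2 * (\<integral>\<omega>. (Y \<omega>)\<^sup>2 \<partial>M) / 2))"
      using Xd Yd by (simp only: exp_add of_real_mult)
    also have "- (t\<^sup>2 * (\<integral>\<omega>. (X \<omega>)\<^sup>2 \<partial>M) / 2) + - (t\<^sup>2 * (\<integral>\<omega>. (Y \<omega>)\<^sup>2 \<partial>M) / 2)
       = - (t\<^sup>2 * (\<integral>\<omega>. (X \<omega> + Y \<omega>)\<^sup>2 \<partial>M) / 2)"
      unfolding sq using Xd Yd int XY by (simp add: distrib_left add_divide_distrib)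
    finally show ?thesis .
  qed
  then show ?thesis
    using Xd Yd int XY unfolding centred_gaussian_def sq by simp
qed

text \<open>A point mass of mean 0 sits at 0. A nondegenerate law is rescaled to the standard normal
  one, whose characteristic function is taken at \<open>t * \<sigma>\<close>.\<close>

lemma centred_gaussian_rv:
  assumes X: "gaussian_rv M X" and mean: "has_bochner_integral M X 0"
  shows "centred_gaussian M X"
proof -
  have [measurable]: "X \<in> borel_measurable M" using X by (simp add: gaussian_rv_def)
  have EX: "integrable M X" "(\<integral>\<omega>. X \<omega> \<partial>M) = 0"
    using mean by (auto simp: has_bochner_integral_iff)
  consider (const) \<mu> where "AE \<omega> in M. X \<omega> = \<mu>"
    | (normal) \<mu> \<sigma> where "\<sigma> > 0" "distributed M lborel X (normal_density \<mu> \<sigma>)"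
    using X by (auto simp: gaussian_rv_def)
  then show ?thesis
  proof cases
    case const
    have "(\<integral>\<omega>. X \<omega> \<partial>M) = (\<integral>\<omega>. \<mu> \<partial>M)"
      using const by (intro integral_cong_AE) auto
    then have "\<mu> = 0" using EX by (simp add: prob_space)
    then have ae: "AE \<omega> in M. X \<omega> = 0" using const by simp
    have "integrable M (\<lambda>\<omega>. (X \<omega>)\<^sup>2) = integrable M (\<lambda>_. 0 :: real)"
      using ae by (intro integrable_cong_AE) auto
    moreover have "(\<integral>\<omega>. (X \<omega>)\<^sup>2 \<partial>M) = (\<integral>\<omega>. 0 \<partial>M)"
      using ae by (intro integral_cong_AE) auto
    moreover have "(\<integral>\<omega>. iexp (t * X \<omega>) \<partial>M) = (\<integral>\<omega>. 1 \<partial>M)" for t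
      using ae by (intro integral_cong_AE) auto
    ultimately show ?thesis
      using EX by (simp add: centred_gaussian_def prob_space)
  next
    case normal
    have "(\<integral>\<omega>. X \<omega> \<partial>M) = \<mu>" by (rule normal_distributed_expectation[OF normal])
    with EX have \<mu>: "\<mu> = 0" by simp
    have var: "(\<integral>\<omega>. (X \<omega>)\<^sup>2 \<partial>M) = \<sigma>\<^sup>2"
      using normal_distributed_variance[OF normal] EX by simp
    have "integrable lborel (\<lambda>t. normal_density \<mu> \<sigma> t * (t - \<mu>)\<^sup>2)"
      by (rule integrable_normal_moment[OF normal(1)])
    then have int: "integrable M (\<lambda>\<omega>. (X \<omega>)\<^sup>2)"
      using distributed_integrable[OF normal(2), of "\<lambda>t. t\<^sup>2"] \<mu> by simp
    have std: "distributed M lborel (\<lambda>\<omega>. X \<omega> / \<sigma>) std_normal_density"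
      using normal_standard_normal_convert[OF normal(1), of X \<mu>] normal(2) \<mu> by simp
    then have d: "distr M borel (\<lambda>\<omega>. X \<omega> / \<sigma>) = std_normal_distribution"
      using distributed_distr_eq_density[OF std] distr_cong[OF refl sets_lborel, of M "\<lambda>\<omega>. X \<omega> / \<sigma>"] by simp
    have "(\<integral>\<omega>. iexp (t * X \<omega>) \<partial>M) = exp (- (t\<^sup>2 * \<sigma>\<^sup>2 / 2))" for t
    proof -
      have "iexp (t * X \<omega>) = iexp ((t * \<sigma>) * (X \<omega> / \<sigma>))" for \<omega> using normal(1) by simp
      then have "(\<integral>\<omega>. iexp (t * X \<omega>) \<partial>M) = (\<integral>\<omega>. iexp ((t * \<sigma>) * (X \<omega> / \<sigma>)) \<partial>M)" by presburger
      also have "\<dots> = char (distr M borel (\<lambda>\<omega>. X \<omega> / \<sigma>)) (t * \<sigma>)"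
        unfolding char_def by (subst integral_distr) auto
      finally show ?thesis unfolding d by (simp add: char_std_normal_distribution power_mult_distrib)
    qed
    then show ?thesis using EX int var by (simp add: centred_gaussian_def)
  qed
qed

text \<open>The derivative at \<open>0\<close> of the characteristic function of \<open>T + t R\<close>, which for Gaussian
  variables depends on \<open>t\<close> only through the variance.\<close>
lemma gaussian_uncorrelated:
  assumes gauss: "\<And>t. centred_gaussian M (\<lambda>\<omega>. T \<omega> + t * R \<omega>)"
    and R: "centred_gaussian M R"
    and uncorrelated: "(\<integral>\<omega>. T \<omega> * R \<omega> \<partial>M) = 0"
  shows "(\<integral>\<omega>. R \<omega> * iexp (T \<omega>) \<partial>M) = 0"
proof -
  have T: "centred_gaussian M T" using gauss[of 0] by simp
  note Td = T[unfolded centred_gaussian_def] and Rd = R[unfolded centred_gaussian_def]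
  have [measurable]: "R \<in> borel_measurable M" "T \<in> borel_measurable M" using Rd Td by auto
  have int: "integrable M R" "integrable M T" "integrable M (\<lambda>\<omega>. T \<omega> * R \<omega>)"
    using Rd Td by (auto intro: integrable_of_square integrable_mult_of_squares)
  define q r I where "q = (\<integral>\<omega>. (T \<omega>)\<^sup>2 \<partial>M)" and "r = (\<integral>\<omega>. (R \<omega>)\<^sup>2 \<partial>M)"
    and "I = (\<integral>\<omega>. R \<omega> * iexp (T \<omega>) \<partial>M)"
  have "r \<ge> 0" "q \<ge> 0" by (simp_all add: q_def r_def)
  have sq: "(T \<omega> + t * R \<omega>)\<^sup>2 = (T \<omega>)\<^sup>2 + t\<^sup>2 * (R \<omega>)\<^sup>2 + 2 * t * (T \<omega> * R \<omega>)" for \<omega> t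
    by (simp add: power2_sum power_mult_distrib)
  have "(\<integral>\<omega>. (T \<omega> + t * R \<omega>)\<^sup>2 \<partial>M) = q + t\<^sup>2 * r" for t
    unfolding sq using Rd Td int uncorrelated by (simp add: q_def r_def)
  moreover have "(\<integral>\<omega>. iexp (1 * (T \<omega> + t * R \<omega>)) \<partial>M)
      = exp (- (1\<^sup>2 * (\<integral>\<omega>. (T \<omega> + t * R \<omega>)\<^sup>2 \<partial>M) / 2))" for t
    using gauss[of t] unfolding centred_gaussian_def by blast
  ultimately have char: "(\<integral>\<omega>. iexp (T \<omega> + t * R \<omega>) \<partial>M) = exp (- ((q + t\<^sup>2 * r) / 2))" for t
    by (simp del: of_real_add)
  have inte: "integrable M (\<lambda>\<omega>. iexp (T \<omega> + t * R \<omega>))" for t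
    by (rule integrable_const_bound[where B = 1]) auto
  have intR: "integrable M (\<lambda>\<omega>. R \<omega> * iexp (T \<omega>))"
    by (rule Bochner_Integration.integrable_bound[OF int(1)]) (auto simp: norm_mult)
  have "t * cmod I \<le> t\<^sup>2 * r" if "t > 0" for t
  proof -
    \<comment> \<open>\<open>D\<close> is the remainder of the expansion to first order in t, with
      linear term \<open>\<i> * t * I\<close>. The pointwise estimate of exp(is) - 1 - is by s^2/2
      makes it of order t^2.\<close>
    define D where "D = (\<integral>\<omega>. iexp (T \<omega> + t * R \<omega>) - iexp (T \<omega> + 0 * R \<omega>) - \<i> * t * (R \<omega> * iexp (T \<omega>)) \<partial>M)"
    have D: "D = exp (- ((q + t\<^sup>2 * r) / 2)) - exp (- (q / 2)) - \<i> * t * I"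
      unfolding D_def I_def using inte[of t] inte[of 0] intR char[of t] char[of 0]
      by simp
    have "norm D \<le> (\<integral>\<omega>. (t\<^sup>2 / 2) * (R \<omega>)\<^sup>2 \<partial>M)"
      unfolding D_def
    proof (rule order_trans[OF integral_norm_bound integral_mono])
      show "integrable M (\<lambda>\<omega>. norm (iexp (T \<omega> + t * R \<omega>) - iexp (T \<omega> + 0 * R \<omega>) - \<i> * t * (R \<omega> * iexp (T \<omega>))))"
        using inte[of t] inte[of 0] intR by simp
      show "integrable M (\<lambda>\<omega>. (t\<^sup>2 / 2) * (R \<omega>)\<^sup>2)" using Rd by simp
      fix \<omega>
      have "iexp (T \<omega> + t * R \<omega>) - iexp (T \<omega> + 0 * R \<omega>) - \<i> * t * (R \<omega> * iexp (T \<omega>))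
          = (iexp (t * R \<omega>) - (1 + \<i> * of_real (t * R \<omega>))) * iexp (T \<omega>)"
        by (simp add: exp_add distrib_left algebra_simps)
      moreover have "cmod (iexp (t * R \<omega>) - (1 + \<i> * of_real (t * R \<omega>))) \<le> (t * R \<omega>)\<^sup>2 / 2"
        using iexp_approx1[of "t * R \<omega>" 1] by (simp add: numeral_2_eq_2[symmetric] fact_numeral del: of_real_mult)
      ultimately show "norm (iexp (T \<omega> + t * R \<omega>) - iexp (T \<omega> + 0 * R \<omega>) - \<i> * t * (R \<omega> * iexp (T \<omega>)))
          \<le> (t\<^sup>2 / 2) * (R \<omega>)\<^sup>2"
        by (simp add: norm_mult power_mult_distrib)
    qed
    then have D_le: "norm D \<le> t\<^sup>2 * r / 2" by (simp add: r_def)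
    \<comment> \<open>Uncorrelatedness leaves only t^2 in the exponent, so the increment of the
      characteristic function is of order t^2 as well. The linear term is the difference of two
      quantities of this order.\<close>
    have "exp (- (q / 2)) - exp (- ((q + t\<^sup>2 * r) / 2)) = exp (- (q / 2)) * (1 - exp (- (t\<^sup>2 * r / 2)))"
      by (simp add: right_diff_distrib exp_add[symmetric] add_divide_distrib)
    also have "\<dots> \<le> 1 * (t\<^sup>2 * r / 2)"
    proof (rule mult_mono)
      show "1 - exp (- (t\<^sup>2 * r / 2)) \<le> t\<^sup>2 * r / 2"
        using exp_ge_add_one_self[of "- (t\<^sup>2 * r / 2)"] by linarith
    qed (use \<open>q \<ge> 0\<close> \<open>r \<ge> 0\<close> in auto)
    finally have e: "\<bar>exp (- ((q + t\<^sup>2 * r) / 2)) - exp (- (q / 2))\<bar> \<le> t\<^sup>2 * r / 2"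
      using exp_le_cancel_iff[of "- ((q + t\<^sup>2 * r) / 2)" "- (q / 2)"] \<open>r \<ge> 0\<close> by simp
    have "\<i> * t * I = of_real (exp (- ((q + t\<^sup>2 * r) / 2)) - exp (- (q / 2))) - D"
      using D by simp
    then have "norm (\<i> * t * I) \<le> \<bar>exp (- ((q + t\<^sup>2 * r) / 2)) - exp (- (q / 2))\<bar> + norm D"
      by (metis norm_triangle_ineq4 norm_of_real)
    with e D_le that show ?thesis by (simp add: norm_mult)
  qed
  then have "cmod I \<le> t * r" if "t > 0" for t
    using that by (simp add: power2_eq_square)
  \<comment> \<open>Division by t has left the bound \<open>t * r\<close>, and t decreases to
    0.\<close>
  then have "cmod I \<le> 0 * r"
    by (intro tendsto_lowerbound[of "\<lambda>t. t * r" _ "at_right 0"] tendsto_intros)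
      (auto simp: eventually_at_right_less eventually_at_filter)
  then show ?thesis by (simp add: I_def)
qed

end

section \<open>The Kalman filter in the learning model\<close>

definition square_integrable :: "'a measure \<Rightarrow> ('a \<Rightarrow> real) set" where
  "square_integrable M = {f \<in> borel_measurable M. integrable M (\<lambda>\<omega>. (f \<omega>)\<^sup>2)}"

lemma square_integrable_mult:
  assumes "f \<in> square_integrable M" "g \<in> square_integrable M"
  shows "integrable M (\<lambda>\<omega>. f \<omega> * g \<omega>)"
  using assms by (auto simp: square_integrable_def intro: integrable_mult_of_squares)

text \<open>The joint law is the product of the marginal laws, so this is Fubini. Both integrals are
  pulled back to \<open>M\<close>: the value of \<open>X\<close> is frozen at one sample point while
  \<open>Y\<close> is averaged over another.\<close>

lemma (in prob_space) indep_var_integral: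
  fixes h :: "'b \<times> 'b \<Rightarrow> 'e::{banach, second_countable_topology}"
  assumes ind: "indep_var S X T Y" and h[measurable]: "h \<in> borel_measurable (S \<Otimes>\<^sub>M T)"
    and int: "integrable M (\<lambda>\<omega>. h (X \<omega>, Y \<omega>))"
  shows "(\<integral>\<omega>. h (X \<omega>, Y \<omega>) \<partial>M) = (\<integral>\<omega>'. (\<integral>\<omega>. h (X \<omega>', Y \<omega>) \<partial>M) \<partial>M)"
proof -
  have [measurable]: "X \<in> measurable M S" "Y \<in> measurable M T"
    using indep_var_rv1[OF ind] indep_var_rv2[OF ind] by auto
  interpret X: prob_space "distr M S X" by (rule prob_space_distr) simp
  interpret Y: prob_space "distr M T Y" by (rule prob_space_distr) simp
  interpret P: pair_prob_space "distr M S X" "distr M T Y" ..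
  have eq: "distr M S X \<Otimes>\<^sub>M distr M T Y = distr M (S \<Otimes>\<^sub>M T) (\<lambda>\<omega>. (X \<omega>, Y \<omega>))"
    using ind by (simp add: indep_var_distribution_eq)
  have "integrable (distr M S X \<Otimes>\<^sub>M distr M T Y) h"
    unfolding eq using int by (simp add: integrable_distr_eq)
  then have "(\<integral>a. (\<integral>b. h (a, b) \<partial>distr M T Y) \<partial>distr M S X) = integral\<^sup>L (distr M S X \<Otimes>\<^sub>M distr M T Y) h"
    by (rule P.integral_fst')
  also have "\<dots> = (\<integral>\<omega>. h (X \<omega>, Y \<omega>) \<partial>M)"
    unfolding eq by (simp add: integral_distr)
  also have "(\<integral>a. (\<integral>b. h (a, b) \<partial>distr M T Y) \<partial>distr M S X) = (\<integral>\<omega>'. (\<integral>b. h (X \<omega>', b) \<partial>distr M T Y) \<partial>M)"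
    by (subst integral_distr) auto
  also have "\<dots> = (\<integral>\<omega>'. (\<integral>\<omega>. h (X \<omega>', Y \<omega>) \<partial>M) \<partial>M)"
    by (intro Bochner_Integration.integral_cong refl)
      (subst integral_distr, auto dest: measurable_space[of X M S])
  finally show ?thesis by simp
qed

text \<open>No integrability is presupposed, so this version can serve to prove that the error is
  square integrable.\<close>

lemma (in prob_space) indep_var_nn_integral:
  assumes ind: "indep_var S X T Y" and h[measurable]: "h \<in> borel_measurable (S \<Otimes>\<^sub>M T)"
  shows "(\<integral>\<^sup>+\<omega>. h (X \<omega>, Y \<omega>) \<partial>M) = (\<integral>\<^sup>+\<omega>'. (\<integral>\<^sup>+\<omega>. h (X \<omega>', Y \<omega>) \<partial>M) \<partial>M)"
proof -
  have [measurable]: "X \<in> measurable M S" "Y \<in> measurable M T"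
    using indep_var_rv1[OF ind] indep_var_rv2[OF ind] by auto
  interpret X: prob_space "distr M S X" by (rule prob_space_distr) simp
  interpret Y: prob_space "distr M T Y" by (rule prob_space_distr) simp
  have eq: "distr M S X \<Otimes>\<^sub>M distr M T Y = distr M (S \<Otimes>\<^sub>M T) (\<lambda>\<omega>. (X \<omega>, Y \<omega>))"
    using ind by (simp add: indep_var_distribution_eq)
  have "(\<integral>\<^sup>+\<omega>. h (X \<omega>, Y \<omega>) \<partial>M) = integral\<^sup>N (distr M S X \<Otimes>\<^sub>M distr M T Y) h"
    unfolding eq by (simp add: nn_integral_distr)
  also have "\<dots> = (\<integral>\<^sup>+a. (\<integral>\<^sup>+b. h (a, b) \<partial>distr M T Y) \<partial>distr M S X)"
    by (rule Y.nn_integral_fst[symmetric]) simp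
  also have "\<dots> = (\<integral>\<^sup>+\<omega>'. (\<integral>\<^sup>+b. h (X \<omega>', b) \<partial>distr M T Y) \<partial>M)"
    by (subst nn_integral_distr) auto
  also have "\<dots> = (\<integral>\<^sup>+\<omega>'. (\<integral>\<^sup>+\<omega>. h (X \<omega>', Y \<omega>) \<partial>M) \<partial>M)"
    by (intro nn_integral_cong) (subst nn_integral_distr, auto dest: measurable_space[of X M S])
  finally show ?thesis .
qed

lemma integrable_vec:
  fixes f :: "'b \<Rightarrow> 'c::euclidean_space^'n"
  assumes "\<And>i. integrable M (\<lambda>\<omega>. f \<omega> $ i)"
  shows "integrable M f"
proof -
  have "bounded_linear (axis i :: 'c \<Rightarrow> 'c^'n)" for i
    by (intro linear_conv_bounded_linear[THEN iffD1] linearI) (auto simp: axis_def vec_eq_iff)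
  then have "integrable M (\<lambda>\<omega>. \<Sum>i\<in>UNIV. axis i (f \<omega> $ i))"
    using assms by (intro Bochner_Integration.integrable_sum integrable_bounded_linear[of "axis _"])
  moreover have "(\<Sum>i\<in>UNIV. axis i (f \<omega> $ i)) = f \<omega>" for \<omega>
    by (simp add: vec_eq_iff axis_def)
  ultimately show ?thesis by simp
qed

lemma integral_vec_nth:
  fixes f :: "'b \<Rightarrow> 'c::euclidean_space^'n"
  assumes "integrable M f"
  shows "(\<integral>\<omega>. f \<omega> \<partial>M) $ i = (\<integral>\<omega>. f \<omega> $ i \<partial>M)"
  using integral_bounded_linear[OF bounded_linear_vec_nth assms] by simp

lemma outer_entry: "outer a b $ i $ j = a $ i * b $ j"
  by (simp add: outer_def matrix_matrix_mult_def columnvector_def rowvector_def)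

text \<open>The coefficients may depend on \<open>a\<close> and on the inputs, but not on the
  outputs \<open>z\<close>; thus the prediction of the next output is a fixed combination of the
  past ones.\<close>

lemma estimate_linear:
  "\<exists>\<beta>. \<forall>z. a \<bullet> estimate Sw s2 c z n = (\<Sum>j<n. \<beta> j * z j)"
proof (induction n arbitrary: a)
  case (Suc n)
  let ?r = "a \<bullet> (error_cov Sw s2 c n *v c n) / (c n \<bullet> (error_cov Sw s2 c n *v c n) + s2)"
  obtain \<beta> \<gamma> where \<beta>: "\<And>z. a \<bullet> estimate Sw s2 c z n = (\<Sum>j<n. \<beta> j * z j)"
    and \<gamma>: "\<And>z. c n \<bullet> estimate Sw s2 c z n = (\<Sum>j<n. \<gamma> j * z j)"
    using Suc[of a] Suc[of "c n"] by blast
  show ?case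
  proof (intro exI allI)
    fix z
    have "a \<bullet> estimate Sw s2 c z (Suc n)
        = (\<Sum>j<n. \<beta> j * z j) + ?r * (z n - (\<Sum>j<n. \<gamma> j * z j))"
      by (simp add: inner_add_right \<beta> \<gamma> inner_commute[of _ "c n"])
    also have "\<dots> = (\<Sum>j<Suc n. (if j = n then ?r else \<beta> j - ?r * \<gamma> j) * z j)"
      by (simp add: left_diff_distrib right_diff_distrib sum_subtractf sum_distrib_left mult.assoc)
    finally show "a \<bullet> estimate Sw s2 c z (Suc n)
        = (\<Sum>j<Suc n. (if j = n then ?r else \<beta> j - ?r * \<gamma> j) * z j)" .
  qed
qed simp

context online_learning
begin

section \<open>Independence of inputs, weight and noises\<close>

lemma measurable_sources [measurable]:
  "w \<in> borel_measurable M" "x k \<in> borel_measurable M" "\<epsilon> k \<in> borel_measurable M"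
  using w_gaussian eps_gaussian x_mean[of k]
  by (auto simp: gaussian_vector_def gaussian_rv_def has_bochner_integral_iff)

text \<open>All sources in one type, so that they form a single independent family. A noise becomes a
  constant vector, so that any coordinate recovers it.\<close>
fun source_var :: "source \<Rightarrow> 'a \<Rightarrow> real^'d" where
  "source_var Weight \<omega> = w \<omega>"
| "source_var (Input k) \<omega> = x k \<omega>"
| "source_var (Noise k) \<omega> = vec (\<epsilon> k \<omega>)"

lemma borel_measurable_vec [measurable]: "(vec :: real \<Rightarrow> real^'n) \<in> borel_measurable borel"
  by (simp add: borel_measurable_vec_iff)

lemma source_var_eq:
  "source_var Weight = w" "source_var (Input k) = x k" "source_var (Noise k) = (\<lambda>\<omega>. vec (\<epsilon> k \<omega>))"
  by (simp_all add: fun_eq_iff)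

lemma indep_source_var: "indep_vars (\<lambda>_. borel) source_var UNIV"
  unfolding indep_vars_def2
proof (intro conjI ballI)
  show "random_variable borel (source_var s)" for s
    by (cases s) (simp_all add: source_var_eq)
  show "indep_sets (\<lambda>s. {source_var s -` A \<inter> space M |A. A \<in> sets borel}) UNIV"
  proof (rule indep_sets_mono_sets[OF independent])
    fix s :: source
    show "{source_var s -` A \<inter> space M |A. A \<in> sets borel} \<subseteq> source_events M w x \<epsilon> s"
    proof (cases s)
      case (Noise k)
      have "source_var s -` A \<inter> space M \<in> source_events M w x \<epsilon> s" if A: "A \<in> sets borel" for A
      proof -
        \<comment> \<open>Embedding a noise by the measurable map \<open>vec\<close> creates no
          events beyond those of the noise itself.\<close>
        have "vec -` A \<inter> space borel \<in> sets (borel :: real measure)"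
          using A by (rule measurable_sets[OF borel_measurable_vec])
        then have "\<epsilon> k -` (vec -` A) \<inter> space M \<in> sets (vimage_algebra (space M) (\<epsilon> k) borel)"
          by (intro in_vimage_algebra) simp
        then show ?thesis using Noise by (simp add: vimage_def)
      qed
      then show ?thesis by auto
    qed (auto simp: source_var_eq intro: in_vimage_algebra)
  qed
qed

lemma indep_var_sources:
  assumes "A \<inter> B = {}"
  shows "indep_var (PiM A (\<lambda>_. borel)) (\<lambda>\<omega>. restrict (\<lambda>s. source_var s \<omega>) A)
           (PiM B (\<lambda>_. borel)) (\<lambda>\<omega>. restrict (\<lambda>s. source_var s \<omega>) B)"
  by (rule indep_var_restrict[OF indep_source_var assms]) auto

abbreviation model_space :: "((nat \<Rightarrow> real^'d) \<times> (real^'d) \<times> (nat \<Rightarrow> real)) measure" where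
  "model_space \<equiv> PiM UNIV (\<lambda>_. borel) \<Otimes>\<^sub>M (borel \<Otimes>\<^sub>M PiM UNIV (\<lambda>_. borel))"

lemma
  shows input_integral: "\<And>h :: _ \<Rightarrow> 'e::{banach, second_countable_topology}.
      h \<in> borel_measurable model_space \<Longrightarrow>
      integrable M (\<lambda>\<omega>. h (\<lambda>j. x j \<omega>, w \<omega>, \<lambda>j. \<epsilon> j \<omega>)) \<Longrightarrow>
      (\<integral>\<omega>. h (\<lambda>j. x j \<omega>, w \<omega>, \<lambda>j. \<epsilon> j \<omega>) \<partial>M)
        = (\<integral>\<omega>'. (\<integral>\<omega>. h (\<lambda>j. x j \<omega>', w \<omega>, \<lambda>j. \<epsilon> j \<omega>) \<partial>M) \<partial>M)"
    and input_nn_integral: "\<And>h :: _ \<Rightarrow> ennreal. h \<in> borel_measurable model_space \<Longrightarrow>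
      (\<integral>\<^sup>+\<omega>. h (\<lambda>j. x j \<omega>, w \<omega>, \<lambda>j. \<epsilon> j \<omega>) \<partial>M)
        = (\<integral>\<^sup>+\<omega>'. (\<integral>\<^sup>+\<omega>. h (\<lambda>j. x j \<omega>', w \<omega>, \<lambda>j. \<epsilon> j \<omega>) \<partial>M) \<partial>M)"
proof -
  let ?A = "range Input" and ?B = "insert Weight (range Noise)"
  let ?f = "\<lambda>g :: source \<Rightarrow> real^'d. \<lambda>j. g (Input j)"
    and ?g = "\<lambda>g :: source \<Rightarrow> real^'d. (g Weight, \<lambda>j. g (Noise j) $ undefined)"
  have f: "?f \<in> measurable (PiM ?A (\<lambda>_. borel)) (PiM UNIV (\<lambda>_. borel))"
    by (intro measurable_PiM_single') (auto intro!: measurable_component_singleton)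
  have g: "?g \<in> measurable (PiM ?B (\<lambda>_. borel)) (borel \<Otimes>\<^sub>M PiM UNIV (\<lambda>_. borel))"
    by (intro measurable_Pair measurable_PiM_single' borel_measurable_vec_nth)
      (auto intro!: measurable_component_singleton)
  have "(\<lambda>p. (?f (fst p), ?g (snd p)))
      \<in> measurable (PiM ?A (\<lambda>_. borel) \<Otimes>\<^sub>M PiM ?B (\<lambda>_. borel)) model_space"
    by (rule measurable_Pair[OF measurable_compose[OF measurable_fst f] measurable_compose[OF measurable_snd g]])
  note meas = measurable_compose[OF this]
  have "?A \<inter> ?B = {}" by auto
  note ind = indep_var_sources[OF this]
  show "(\<integral>\<omega>. h (\<lambda>j. x j \<omega>, w \<omega>, \<lambda>j. \<epsilon> j \<omega>) \<partial>M)
        = (\<integral>\<omega>'. (\<integral>\<omega>. h (\<lambda>j. x j \<omega>', w \<omega>, \<lambda>j. \<epsilon> j \<omega>) \<partial>M) \<partial>M)"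
    if "h \<in> borel_measurable model_space" "integrable M (\<lambda>\<omega>. h (\<lambda>j. x j \<omega>, w \<omega>, \<lambda>j. \<epsilon> j \<omega>))"
    for h :: "_ \<Rightarrow> 'e"
    using indep_var_integral[OF ind meas[OF that(1)]] that(2) by simp
  show "(\<integral>\<^sup>+\<omega>. h (\<lambda>j. x j \<omega>, w \<omega>, \<lambda>j. \<epsilon> j \<omega>) \<partial>M)
        = (\<integral>\<^sup>+\<omega>'. (\<integral>\<^sup>+\<omega>. h (\<lambda>j. x j \<omega>', w \<omega>, \<lambda>j. \<epsilon> j \<omega>) \<partial>M) \<partial>M)"
    if "h \<in> borel_measurable model_space" for h :: "_ \<Rightarrow> ennreal"
    using indep_var_nn_integral[OF ind meas[OF that]] by simp
qed

lemma next_input_integral: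
  fixes h :: "(nat \<Rightarrow> real^'d) \<times> (real^'d) \<Rightarrow> 'e::{banach, second_countable_topology}"
  assumes h: "h \<in> borel_measurable (PiM {..<n} (\<lambda>_. borel) \<Otimes>\<^sub>M borel)"
    and int: "integrable M (\<lambda>\<omega>. h (\<lambda>j\<in>{..<n}. x j \<omega>, x n \<omega>))"
  shows "(\<integral>\<omega>. h (\<lambda>j\<in>{..<n}. x j \<omega>, x n \<omega>) \<partial>M)
           = (\<integral>\<omega>'. (\<integral>\<omega>. h (\<lambda>j\<in>{..<n}. x j \<omega>', x n \<omega>) \<partial>M) \<partial>M)"
proof -
  let ?A = "Input ` {..<n}" and ?B = "{Input n}"
  let ?f = "\<lambda>g :: source \<Rightarrow> real^'d. \<lambda>j\<in>{..<n}. g (Input j)"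
    and ?g = "\<lambda>g :: source \<Rightarrow> real^'d. g (Input n)"
  have f: "?f \<in> measurable (PiM ?A (\<lambda>_. borel)) (PiM {..<n} (\<lambda>_. borel))"
    by (intro measurable_restrict measurable_component_singleton) auto
  have g: "?g \<in> measurable (PiM ?B (\<lambda>_. borel)) borel"
    by (intro measurable_component_singleton) auto
  have "(\<lambda>p. (?f (fst p), ?g (snd p)))
      \<in> measurable (PiM ?A (\<lambda>_. borel) \<Otimes>\<^sub>M PiM ?B (\<lambda>_. borel)) (PiM {..<n} (\<lambda>_. borel) \<Otimes>\<^sub>M borel)"
    by (rule measurable_Pair[OF measurable_compose[OF measurable_fst f] measurable_compose[OF measurable_snd g]])
  note meas = measurable_compose[OF this h]
  have "?A \<inter> ?B = {}" by auto
  note ind = indep_var_sources[OF this]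
  have restr: "?f (restrict (\<lambda>s. source_var s \<omega>) ?A) = (\<lambda>j\<in>{..<n}. x j \<omega>)" for \<omega>
    by (auto simp: fun_eq_iff)
  show ?thesis
    using indep_var_integral[OF ind meas] int
    by (simp only: fst_conv snd_conv restr) simp
qed

section \<open>Linear forms in the weight and the noises\<close>

lemma centred_gaussian_noise: "centred_gaussian M (\<epsilon> k)"
  by (intro centred_gaussian_rv eps_gaussian eps_mean)

lemma centred_gaussian_weight: "centred_gaussian M (\<lambda>\<omega>. a \<bullet> w \<omega>)"
proof (rule centred_gaussian_rv)
  show "gaussian_rv M (\<lambda>\<omega>. a \<bullet> w \<omega>)" using w_gaussian by (simp add: gaussian_vector_def)
  show "has_bochner_integral M (\<lambda>\<omega>. a \<bullet> w \<omega>) 0"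
    using has_bochner_integral_inner_right[of a M w 0] w_mean by simp
qed

lemma noise_second_moment: "(\<integral>\<omega>. (\<epsilon> k \<omega>)\<^sup>2 \<partial>M) = s2"
  using eps_var[of k] eps_mean[of k] by (simp add: has_bochner_integral_iff)

text \<open>The span of the coordinates of the weight and the first n noises. Every linear
  combination of members is a member and hence Gaussian, which takes the place of joint normality of
  vectors.\<close>

definition linear_obs :: "nat \<Rightarrow> ('a \<Rightarrow> real) set" where
  "linear_obs n = {X. \<exists>v b. X = (\<lambda>\<omega>. v \<bullet> w \<omega> + (\<Sum>j<n. b j * \<epsilon> j \<omega>))}"

lemma linear_obs_add:
  assumes "X \<in> linear_obs n" "Y \<in> linear_obs n"
  shows "(\<lambda>\<omega>. X \<omega> + Y \<omega>) \<in> linear_obs n"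
proof -
  obtain v b v' b' where "X = (\<lambda>\<omega>. v \<bullet> w \<omega> + (\<Sum>j<n. b j * \<epsilon> j \<omega>))"
      "Y = (\<lambda>\<omega>. v' \<bullet> w \<omega> + (\<Sum>j<n. b' j * \<epsilon> j \<omega>))"
    using assms unfolding linear_obs_def by blast
  then have "(\<lambda>\<omega>. X \<omega> + Y \<omega>) = (\<lambda>\<omega>. (v + v') \<bullet> w \<omega> + (\<Sum>j<n. (b j + b' j) * \<epsilon> j \<omega>))"
    by (simp add: inner_add_left distrib_right sum.distrib algebra_simps)
  then show ?thesis unfolding linear_obs_def mem_Collect_eq by (intro exI)
qed

lemma linear_obs_scale:
  assumes "X \<in> linear_obs n"
  shows "(\<lambda>\<omega>. r * X \<omega>) \<in> linear_obs n"
proof -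
  obtain v b where "X = (\<lambda>\<omega>. v \<bullet> w \<omega> + (\<Sum>j<n. b j * \<epsilon> j \<omega>))"
    using assms unfolding linear_obs_def by blast
  then have "(\<lambda>\<omega>. r * X \<omega>) = (\<lambda>\<omega>. (r *\<^sub>R v) \<bullet> w \<omega> + (\<Sum>j<n. (r * b j) * \<epsilon> j \<omega>))"
    by (simp add: distrib_left sum_distrib_left mult.assoc)
  then show ?thesis unfolding linear_obs_def mem_Collect_eq by (intro exI)
qed

lemma linear_obs_weight: "(\<lambda>\<omega>. v \<bullet> w \<omega>) \<in> linear_obs n"
  unfolding linear_obs_def mem_Collect_eq by (rule exI[of _ v], rule exI[of _ "\<lambda>_. 0"]) simp

lemma linear_obs_noise: "j < n \<Longrightarrow> \<epsilon> j \<in> linear_obs n"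
  unfolding linear_obs_def mem_Collect_eq
  by (rule exI[of _ 0], rule exI[of _ "\<lambda>i. if i = j then 1 else 0"])
    (simp add: if_distrib if_distribR cong: if_cong)

lemma linear_obs_sum:
  assumes "\<And>i. i \<in> I \<Longrightarrow> X i \<in> linear_obs n"
  shows "(\<lambda>\<omega>. \<Sum>i\<in>I. X i \<omega>) \<in> linear_obs n"
  using assms linear_obs_weight[of 0 n]
  by (induction I rule: infinite_finite_induct) (auto simp: linear_obs_add)

lemma linear_obs_mono:
  assumes "X \<in> linear_obs n" "n \<le> m"
  shows "X \<in> linear_obs m"
proof -
  obtain v b where X: "X = (\<lambda>\<omega>. v \<bullet> w \<omega> + (\<Sum>j<n. b j * \<epsilon> j \<omega>))"
    using assms unfolding linear_obs_def by blast
  show ?thesis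
    unfolding X using assms(2)
    by (intro linear_obs_add linear_obs_weight linear_obs_sum linear_obs_scale linear_obs_noise) auto
qed

lemma indep_var_linear_obs_noise:
  assumes X: "X \<in> linear_obs n" and nm: "n \<le> m"
  shows "indep_var borel X borel (\<epsilon> m)"
proof -
  obtain v b where X: "X = (\<lambda>\<omega>. v \<bullet> w \<omega> + (\<Sum>j<n. b j * \<epsilon> j \<omega>))"
    using X unfolding linear_obs_def by blast
  let ?A = "insert Weight (Noise ` {..<n})" and ?B = "{Noise m}"
  let ?f = "\<lambda>g :: source \<Rightarrow> real^'d. v \<bullet> g Weight + (\<Sum>j<n. b j * g (Noise j) $ undefined)"
  note indep_var_sources[of ?A ?B]
  moreover have "?f \<in> measurable (PiM ?A (\<lambda>_. borel)) borel"
    by (intro borel_measurable_add borel_measurable_inner borel_measurable_sum borel_measurable_times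
        borel_measurable_vec_nth measurable_component_singleton) auto
  moreover have "(\<lambda>g :: source \<Rightarrow> real^'d. g (Noise m) $ undefined) \<in> measurable (PiM ?B (\<lambda>_. borel)) borel"
    by (intro borel_measurable_vec_nth measurable_component_singleton) auto
  moreover have "?A \<inter> ?B = {}" using nm by auto
  ultimately have "indep_var borel (?f \<circ> (\<lambda>\<omega>. restrict (\<lambda>s. source_var s \<omega>) ?A))
      borel ((\<lambda>g. g (Noise m) $ undefined) \<circ> (\<lambda>\<omega>. restrict (\<lambda>s. source_var s \<omega>) ?B))"
    by (intro indep_var_compose) auto
  moreover have "?f \<circ> (\<lambda>\<omega>. restrict (\<lambda>s. source_var s \<omega>) ?A) = X"
    by (auto simp: fun_eq_iff X)
  moreover have "(\<lambda>g. g (Noise m) $ undefined) \<circ> (\<lambda>\<omega>. restrict (\<lambda>s. source_var s \<omega>) ?B) = \<epsilon> m"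
    by (auto simp: fun_eq_iff)
  ultimately show ?thesis by simp
qed

lemma centred_gaussian_linear_obs:
  assumes "X \<in> linear_obs n"
  shows "centred_gaussian M X"
proof -
  have "centred_gaussian M (\<lambda>\<omega>. v \<bullet> w \<omega> + (\<Sum>j<n. b j * \<epsilon> j \<omega>))" for v b
  proof (induction n)
    case (Suc n)
    let ?X = "\<lambda>\<omega>. v \<bullet> w \<omega> + (\<Sum>j<n. b j * \<epsilon> j \<omega>)"
    have "?X \<in> linear_obs n" unfolding linear_obs_def by blast
    then have "indep_var borel ?X borel (\<epsilon> n)" by (rule indep_var_linear_obs_noise) simp
    then have "indep_var borel ?X borel (\<lambda>\<omega>. b n * \<epsilon> n \<omega>)"
      using indep_var_compose[of borel ?X borel "\<epsilon> n" "\<lambda>t. t" borel "\<lambda>t. b n * t" borel]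
      by (simp add: comp_def)
    then have "centred_gaussian M (\<lambda>\<omega>. ?X \<omega> + b n * \<epsilon> n \<omega>)"
      by (rule centred_gaussian_add[OF _ Suc centred_gaussian_scale[OF centred_gaussian_noise]])
    then show ?case by (simp add: add.assoc)
  qed (simp add: centred_gaussian_weight)
  then show ?thesis using assms unfolding linear_obs_def by blast
qed

lemma square_integrable_linear_obs: "X \<in> linear_obs n \<Longrightarrow> X \<in> square_integrable M"
  using centred_gaussian_linear_obs by (simp add: centred_gaussian_def square_integrable_def)

lemma linear_obs_noise_uncorrelated:
  assumes "X \<in> linear_obs n" "n \<le> m"
  shows "(\<integral>\<omega>. X \<omega> * \<epsilon> m \<omega> \<partial>M) = 0"
proof -
  have "X \<in> square_integrable M" "\<epsilon> m \<in> square_integrable M"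
    using assms square_integrable_linear_obs linear_obs_noise by blast+
  then have "integrable M X" "integrable M (\<epsilon> m)"
    by (auto simp: square_integrable_def intro: integrable_of_square)
  then have "(\<integral>\<omega>. X \<omega> * \<epsilon> m \<omega> \<partial>M) = (\<integral>\<omega>. X \<omega> \<partial>M) * (\<integral>\<omega>. \<epsilon> m \<omega> \<partial>M)"
    by (rule indep_var_lebesgue_integral[OF indep_var_linear_obs_noise[OF assms]])
  then show ?thesis using eps_mean[of m] by (simp add: has_bochner_integral_iff)
qed

lemma weight_covariance: "(\<integral>\<omega>. (a \<bullet> w \<omega>) * (b \<bullet> w \<omega>) \<partial>M) = a \<bullet> (Sw *v b)"
proof -
  have int: "integrable M (\<lambda>\<omega>. w \<omega> $ i * w \<omega> $ j)" for i j
    using square_integrable_mult[OF square_integrable_linear_obs[OF linear_obs_weight[of "axis i 1"]]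
        square_integrable_linear_obs[OF linear_obs_weight[of "axis j 1"]]]
    by (simp add: inner_axis')
  have int_outer: "integrable M (\<lambda>\<omega>. outer (w \<omega>) (w \<omega>))"
    by (intro integrable_vec) (simp add: outer_entry int)
  have "Sw = (\<integral>\<omega>. outer (w \<omega>) (w \<omega>) \<partial>M)"
    using w_cov w_mean by (simp add: cov_matrix_def has_bochner_integral_iff)
  then have entry: "Sw $ i $ j = (\<integral>\<omega>. w \<omega> $ i * w \<omega> $ j \<partial>M)" for i j
    using int_outer integrable_bounded_linear[OF bounded_linear_vec_nth int_outer]
    by (simp add: integral_vec_nth outer_entry)
  have "(\<integral>\<omega>. (a \<bullet> w \<omega>) * (b \<bullet> w \<omega>) \<partial>M)
      = (\<integral>\<omega>. (\<Sum>i\<in>UNIV. \<Sum>j\<in>UNIV. (a $ i * b $ j) * (w \<omega> $ i * w \<omega> $ j)) \<partial>M)"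
    by (simp add: inner_vec_def sum_product mult_ac)
  also have "\<dots> = (\<Sum>i\<in>UNIV. \<Sum>j\<in>UNIV. (a $ i * b $ j) * Sw $ i $ j)"
    using int by (simp add: entry)
  also have "\<dots> = a \<bullet> (Sw *v b)"
    by (simp add: inner_vec_def matrix_vector_mult_def sum_distrib_left mult_ac)
  finally show ?thesis .
qed

lemma psd_Sw: "psd Sw"
  unfolding psd_def
proof (intro conjI allI)
  have "Sw $ i $ j = Sw $ j $ i" for i j
    using weight_covariance[of "axis i 1" "axis j 1"] weight_covariance[of "axis j 1" "axis i 1"]
    by (simp add: inner_axis_mult mult.commute)
  then show "transpose Sw = Sw" by (simp add: transpose_def vec_eq_iff)
  show "0 \<le> a \<bullet> (Sw *v a)" for a
    unfolding weight_covariance[symmetric] by (intro integral_nonneg_AE) simp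
qed

section \<open>The Kalman error for frozen inputs\<close>

definition kalman_error :: "(nat \<Rightarrow> real^'d) \<Rightarrow> nat \<Rightarrow> 'a \<Rightarrow> real^'d" where
  "kalman_error c n \<omega> = w \<omega> - estimate Sw s2 c (\<lambda>j. w \<omega> \<bullet> c j + \<epsilon> j \<omega>) n"

abbreviation "S c n \<equiv> error_cov Sw s2 c n"

text \<open>The last bracket is the innovation, that is, the new output minus its prediction from
  the past ones.\<close>

lemma kalman_error_Suc:
  "a \<bullet> kalman_error c (Suc n) \<omega> = a \<bullet> kalman_error c n \<omega>
     - ((a \<bullet> (S c n *v c n)) / (c n \<bullet> (S c n *v c n) + s2)) * (c n \<bullet> kalman_error c n \<omega> + \<epsilon> n \<omega>)"
  by (simp add: kalman_error_def inner_add_right inner_diff_right inner_commute algebra_simps add_divide_distrib diff_divide_distrib)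

lemma obs_linear_obs: "j < n \<Longrightarrow> (\<lambda>\<omega>. w \<omega> \<bullet> c j + \<epsilon> j \<omega>) \<in> linear_obs n"
  by (subst inner_commute) (intro linear_obs_add linear_obs_weight linear_obs_noise)

lemma kalman_error_linear_obs: "(\<lambda>\<omega>. a \<bullet> kalman_error c n \<omega>) \<in> linear_obs n"
proof (induction n arbitrary: a)
  case 0
  show ?case by (simp add: kalman_error_def linear_obs_weight)
next
  case (Suc n)
  have IH: "(\<lambda>\<omega>. b \<bullet> kalman_error c n \<omega>) \<in> linear_obs (Suc n)" for b
    by (rule linear_obs_mono[OF Suc]) simp
  have "(\<lambda>\<omega>. a \<bullet> kalman_error c n \<omega>
     + (- ((a \<bullet> (S c n *v c n)) / (c n \<bullet> (S c n *v c n) + s2))) * (c n \<bullet> kalman_error c n \<omega> + \<epsilon> n \<omega>))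
      \<in> linear_obs (Suc n)"
    by (intro linear_obs_add linear_obs_scale linear_obs_noise IH) simp
  then show ?case unfolding kalman_error_Suc by simp
qed

text \<open>Both claims share one induction, since orthogonality to the newest output uses the
  covariance at the previous time. The gain makes the updated error uncorrelated with the
  innovation, and the newest output is the innovation plus a combination of past outputs.\<close>

lemma
  shows kalman_error_covariance:
      "(\<integral>\<omega>. (a \<bullet> kalman_error c n \<omega>) * (b \<bullet> kalman_error c n \<omega>) \<partial>M) = a \<bullet> (S c n *v b)"
    and kalman_error_orthogonal:
      "j < n \<Longrightarrow> (\<integral>\<omega>. (a \<bullet> kalman_error c n \<omega>) * (w \<omega> \<bullet> c j + \<epsilon> j \<omega>) \<partial>M) = 0"
proof (induction n arbitrary: a b j)
  case 0
  {
    case 1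
    show ?case by (simp add: kalman_error_def weight_covariance)
  next
    case 2
    then show ?case by simp
  }
next
  case (Suc n)
  define r where "r = c n \<bullet> (S c n *v c n) + s2"
  have r: "r \<noteq> 0" using error_cov_denominator_pos[OF psd_Sw s2_pos, of "c n" c n] by (simp add: r_def)
  define E where "E = (\<lambda>a \<omega>. a \<bullet> kalman_error c n \<omega>)"
  define \<alpha> where "\<alpha> = (\<lambda>a. (a \<bullet> (S c n *v c n)) / r)"
  have E': "a \<bullet> kalman_error c (Suc n) \<omega> = E a \<omega> - \<alpha> a * (E (c n) \<omega> + \<epsilon> n \<omega>)" for a \<omega>
    unfolding kalman_error_Suc by (simp add: E_def \<alpha>_def r_def)
  have E_lin: "E a \<in> linear_obs n" for a unfolding E_def by (rule kalman_error_linear_obs)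
  then have E_sq: "E a \<in> square_integrable M" for a using square_integrable_linear_obs by blast
  have eps_sq: "\<epsilon> j \<in> square_integrable M" for j
    using linear_obs_noise[of j "Suc j"] square_integrable_linear_obs by blast
  have obs_sq: "(\<lambda>\<omega>. w \<omega> \<bullet> c j + \<epsilon> j \<omega>) \<in> square_integrable M" for j
    using obs_linear_obs[of j "Suc j"] square_integrable_linear_obs by blast
  note int = square_integrable_mult[OF E_sq E_sq] square_integrable_mult[OF E_sq eps_sq]
    square_integrable_mult[OF eps_sq eps_sq] square_integrable_mult[OF E_sq obs_sq]
    square_integrable_mult[OF obs_sq eps_sq]
  have EE: "(\<integral>\<omega>. E a \<omega> * E b \<omega> \<partial>M) = a \<bullet> (S c n *v b)" for a b
    unfolding E_def by (rule Suc.IH(1))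
  have Ee: "(\<integral>\<omega>. E a \<omega> * \<epsilon> n \<omega> \<partial>M) = 0" for a
    by (rule linear_obs_noise_uncorrelated[OF E_lin]) simp
  have ee: "(\<integral>\<omega>. \<epsilon> n \<omega> * \<epsilon> n \<omega> \<partial>M) = s2"
    using noise_second_moment[of n] by (simp add: power2_eq_square)
  have sym: "a \<bullet> (S c n *v b) = b \<bullet> (S c n *v a)" for a b
    using psd_error_cov[OF psd_Sw s2_pos, of c n] by (intro symmetric_inner) (simp add: psd_def)
  \<comment> \<open>With free scalars one expansion serves twice: \<open>\<alpha> a\<close> and
    \<open>\<alpha> b\<close> give the new covariance, while -1 as second scalar gives the
    correlation with the innovation.\<close>
  have cov: "(\<integral>\<omega>. (E a \<omega> - t * (E (c n) \<omega> + \<epsilon> n \<omega>)) * (E b \<omega> - u * (E (c n) \<omega> + \<epsilon> n \<omega>)) \<partial>M)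
      = a \<bullet> (S c n *v b) - u * (a \<bullet> (S c n *v c n)) - t * (b \<bullet> (S c n *v c n)) + t * u * r" for a b t u
  proof -
    have "(E a \<omega> - t * (E (c n) \<omega> + \<epsilon> n \<omega>)) * (E b \<omega> - u * (E (c n) \<omega> + \<epsilon> n \<omega>))
      = E a \<omega> * E b \<omega> - u * (E a \<omega> * E (c n) \<omega>) - u * (E a \<omega> * \<epsilon> n \<omega>)
        - t * (E b \<omega> * E (c n) \<omega>) - t * (E b \<omega> * \<epsilon> n \<omega>)
        + t * u * (E (c n) \<omega> * E (c n) \<omega>) + 2 * t * u * (E (c n) \<omega> * \<epsilon> n \<omega>)
        + t * u * (\<epsilon> n \<omega> * \<epsilon> n \<omega>)" for \<omega>
      by (simp add: algebra_simps)
    then show ?thesis using int by (simp add: EE Ee ee) (simp add: r_def algebra_simps)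
  qed
  {
    case 1
    show ?case
      unfolding E' cov error_cov_form_Suc[OF psd_Sw s2_pos]
      unfolding r_def[symmetric] \<alpha>_def using r by (simp add: field_simps)
  }
  {
    case 2
    have past: "(\<integral>\<omega>. (E a \<omega> - \<alpha> a * (E (c n) \<omega> + \<epsilon> n \<omega>)) * (w \<omega> \<bullet> c j + \<epsilon> j \<omega>) \<partial>M) = 0"
      if "j < n" for j a
    proof -
      have "(E a \<omega> - \<alpha> a * (E (c n) \<omega> + \<epsilon> n \<omega>)) * (w \<omega> \<bullet> c j + \<epsilon> j \<omega>)
        = E a \<omega> * (w \<omega> \<bullet> c j + \<epsilon> j \<omega>) - \<alpha> a * (E (c n) \<omega> * (w \<omega> \<bullet> c j + \<epsilon> j \<omega>))
          - \<alpha> a * ((w \<omega> \<bullet> c j + \<epsilon> j \<omega>) * \<epsilon> n \<omega>)" for \<omega>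
        by (simp add: algebra_simps)
      moreover have "(\<integral>\<omega>. (w \<omega> \<bullet> c j + \<epsilon> j \<omega>) * \<epsilon> n \<omega> \<partial>M) = 0"
        using that by (intro linear_obs_noise_uncorrelated[OF obs_linear_obs]) auto
      moreover have "(\<integral>\<omega>. E a \<omega> * (w \<omega> \<bullet> c j + \<epsilon> j \<omega>) \<partial>M) = 0" for a
        unfolding E_def using that by (rule Suc.IH(2))
      ultimately show ?thesis using int by simp
    qed
    show ?case
    proof (cases "j < n")
      case True
      then show ?thesis unfolding E' by (rule past)
    next
      case False
      with 2 have j: "j = n" by simp
      let ?E = "\<lambda>\<omega>. E a \<omega> - \<alpha> a * (E (c n) \<omega> + \<epsilon> n \<omega>)"
      obtain \<beta> where \<beta>: "\<And>z. c n \<bullet> estimate Sw s2 c z n = (\<Sum>j<n. \<beta> j * z j)"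
        using estimate_linear by blast
      have "?E \<in> square_integrable M"
        using square_integrable_linear_obs[OF kalman_error_linear_obs, of a c "Suc n"] unfolding E' .
      note int' = square_integrable_mult[OF this obs_sq] square_integrable_mult[OF this E_sq]
        square_integrable_mult[OF this eps_sq]
      have innov: "w \<omega> \<bullet> c n + \<epsilon> n \<omega>
          = (E (c n) \<omega> + \<epsilon> n \<omega>) + (\<Sum>j<n. \<beta> j * (w \<omega> \<bullet> c j + \<epsilon> j \<omega>))" for \<omega>
        unfolding \<beta>[symmetric] by (simp add: E_def kalman_error_def inner_diff_right inner_commute)
      \<comment> \<open>With the zero vector and the scalar -1, the second factor in
        \<open>cov\<close> is exactly the innovation; the value of \<open>\<alpha> a\<close> cancels
        the two remaining terms.\<close>
      have "(\<integral>\<omega>. ?E \<omega> * (E (c n) \<omega> + \<epsilon> n \<omega>) \<partial>M) = 0"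
        using cov[of a "\<alpha> a" 0 "-1"] r by (simp add: E_def \<alpha>_def add.commute)
      moreover have "(\<integral>\<omega>. ?E \<omega> * (\<Sum>j<n. \<beta> j * (w \<omega> \<bullet> c j + \<epsilon> j \<omega>)) \<partial>M) = 0"
      proof -
        have "?E \<omega> * (\<Sum>j<n. \<beta> j * (w \<omega> \<bullet> c j + \<epsilon> j \<omega>))
            = (\<Sum>j<n. \<beta> j * (?E \<omega> * (w \<omega> \<bullet> c j + \<epsilon> j \<omega>)))" for \<omega>
          unfolding sum_distrib_left by (simp only: mult.left_commute)
        then show ?thesis using int' past by simp
      qed
      moreover have "integrable M (\<lambda>\<omega>. ?E \<omega> * (E (c n) \<omega> + \<epsilon> n \<omega>))"
        using int' by (simp add: distrib_left)
      moreover have "integrable M (\<lambda>\<omega>. ?E \<omega> * (\<Sum>j<n. \<beta> j * (w \<omega> \<bullet> c j + \<epsilon> j \<omega>)))"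
        using int'(1) unfolding sum_distrib_left
        by (simp only: mult.left_commute[of "?E _"]) simp
      ultimately show ?thesis
        unfolding j innov E' distrib_left[of "?E _"] by simp
    qed
  }
qed

text \<open>The error and the combinations of outputs lie in the common space
  \<open>linear_obs n\<close>, so \<open>gaussian_uncorrelated\<close> lifts orthogonality from the
  outputs to their exponentials.\<close>

lemma kalman_error_char:
  "(\<integral>\<omega>. (a \<bullet> kalman_error c n \<omega>) * iexp (\<Sum>j<n. b j * (w \<omega> \<bullet> c j + \<epsilon> j \<omega>)) \<partial>M) = 0"
proof (rule gaussian_uncorrelated)
  have obs: "(\<lambda>\<omega>. \<Sum>j<n. b j * (w \<omega> \<bullet> c j + \<epsilon> j \<omega>)) \<in> linear_obs n"
    by (intro linear_obs_sum linear_obs_scale obs_linear_obs) simp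
  show "centred_gaussian M (\<lambda>\<omega>. (\<Sum>j<n. b j * (w \<omega> \<bullet> c j + \<epsilon> j \<omega>)) + t * (a \<bullet> kalman_error c n \<omega>))" for t
    by (intro centred_gaussian_linear_obs[where n = n] linear_obs_add linear_obs_scale obs kalman_error_linear_obs)
  show "centred_gaussian M (\<lambda>\<omega>. a \<bullet> kalman_error c n \<omega>)"
    by (rule centred_gaussian_linear_obs[OF kalman_error_linear_obs])
  have "(\<Sum>j<n. b j * (w \<omega> \<bullet> c j + \<epsilon> j \<omega>)) * (a \<bullet> kalman_error c n \<omega>)
      = (\<Sum>j<n. b j * ((a \<bullet> kalman_error c n \<omega>) * (w \<omega> \<bullet> c j + \<epsilon> j \<omega>)))" for \<omega>
    unfolding sum_distrib_right by (simp only: mult_ac)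
  moreover have "integrable M (\<lambda>\<omega>. (a \<bullet> kalman_error c n \<omega>) * (w \<omega> \<bullet> c j + \<epsilon> j \<omega>))" if "j < n" for j
    using that by (intro square_integrable_mult square_integrable_linear_obs[OF kalman_error_linear_obs]
      square_integrable_linear_obs[OF obs_linear_obs])
  ultimately show "(\<integral>\<omega>. (\<Sum>j<n. b j * (w \<omega> \<bullet> c j + \<epsilon> j \<omega>)) * (a \<bullet> kalman_error c n \<omega>) \<partial>M) = 0"
    by (simp add: kalman_error_orthogonal)
qed

end

text \<open>As \<open>R\<close> is signed, uniqueness on boxes is applied to two finite measures,
  the images of \<open>M\<close> weighted by the positive and the negative part of
  \<open>R\<close>.\<close>

lemma integral_indicator_PiM_eq_0:
  fixes R :: "'a \<Rightarrow> real"
  assumes I: "finite I" and R: "integrable M R"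
    and \<psi>: "\<And>s. s \<in> I \<Longrightarrow> \<psi> s \<in> measurable M (N s)"
    and box: "\<And>A. (\<And>s. s \<in> I \<Longrightarrow> A s \<in> sets (N s)) \<Longrightarrow>
      (\<integral>\<omega>. R \<omega> * (\<Prod>s\<in>I. indicator (A s) (\<psi> s \<omega>)) \<partial>M) = 0"
    and B: "B \<in> sets (PiM I N)"
  shows "(\<integral>\<omega>. R \<omega> * indicator B (\<lambda>s\<in>I. \<psi> s \<omega>) \<partial>M) = 0"
proof -
  define \<Psi> where "\<Psi> = (\<lambda>\<omega>. \<lambda>s\<in>I. \<psi> s \<omega>)"
  have [measurable]: "\<Psi> \<in> measurable M (PiM I N)"
    unfolding \<Psi>_def by (intro measurable_restrict \<psi>)
  define P Q where "P = (\<lambda>\<omega>. max 0 (R \<omega>))" and "Q = (\<lambda>\<omega>. max 0 (- R \<omega>))"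
  have int: "integrable M P" "integrable M Q" using R by (auto simp: P_def Q_def)
  note [measurable] = borel_measurable_integrable[OF int(1)] borel_measurable_integrable[OF int(2)]
  have nonneg: "0 \<le> P \<omega>" "0 \<le> Q \<omega>" for \<omega> by (auto simp: P_def Q_def)
  have R_eq: "R \<omega> = P \<omega> - Q \<omega>" for \<omega> by (auto simp: P_def Q_def)
  have inti: "integrable M (\<lambda>\<omega>. f \<omega> * indicator A (\<Psi> \<omega>))"
    if "integrable M f" "A \<in> sets (PiM I N)" for f :: "'a \<Rightarrow> real" and A
  proof -
    note [measurable] = borel_measurable_integrable[OF that(1)] that(2)
    show ?thesis
      by (rule Bochner_Integration.integrable_bound[OF that(1)]) (auto simp: indicator_def)
  qed
  define \<mu> where "\<mu> = (\<lambda>f :: 'a \<Rightarrow> real. distr (density M (\<lambda>\<omega>. ennreal (f \<omega>))) (PiM I N) \<Psi>)"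
  have \<mu>: "emeasure (\<mu> f) A = ennreal (\<integral>\<omega>. f \<omega> * indicator A (\<Psi> \<omega>) \<partial>M)"
    if f: "integrable M f" "\<And>\<omega>. 0 \<le> f \<omega>" and A: "A \<in> sets (PiM I N)" for f A
  proof -
    note [measurable] = borel_measurable_integrable[OF f(1)] A
    have "emeasure (\<mu> f) A = (\<integral>\<^sup>+\<omega>. ennreal (f \<omega>) * indicator (\<Psi> -` A \<inter> space M) \<omega> \<partial>M)"
      unfolding \<mu>_def by (simp add: emeasure_distr emeasure_density)
    also have "\<dots> = (\<integral>\<^sup>+\<omega>. ennreal (f \<omega> * indicator A (\<Psi> \<omega>)) \<partial>M)"
      by (intro nn_integral_cong) (auto simp: indicator_def)
    also have "\<dots> = ennreal (\<integral>\<omega>. f \<omega> * indicator A (\<Psi> \<omega>) \<partial>M)"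
      using inti[OF f(1) A] f(2) by (intro nn_integral_eq_integral) auto
    finally show ?thesis .
  qed
  have "\<mu> P = \<mu> Q"
  proof (rule measure_eqI_PiM_finite[OF I])
    show "sets (\<mu> P) = sets (PiM I N)" "sets (\<mu> Q) = sets (PiM I N)" by (simp_all add: \<mu>_def)
    show "range (\<lambda>_::nat. space (PiM I N)) \<subseteq> prod_algebra I N"
      using I by (auto simp: space_PiM intro!: prod_algebraI_finite)
    show "emeasure (\<mu> P) (space (PiM I N)) \<noteq> \<infinity>"
      using \<mu>[OF int(1) nonneg(1), of "space (PiM I N)"] by simp
  next
    fix A assume A: "\<And>s. s \<in> I \<Longrightarrow> A s \<in> sets (N s)"
    have Pi: "Pi\<^sub>E I A \<in> sets (PiM I N)" using I A by (intro sets_PiM_I_finite)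
    have "indicator (Pi\<^sub>E I A) (\<Psi> \<omega>) = (\<Prod>s\<in>I. indicator (A s) (\<psi> s \<omega>) :: real)" for \<omega>
      using I by (auto simp: \<Psi>_def indicator_def PiE_iff prod_zero_iff)
    then have "(\<integral>\<omega>. R \<omega> * indicator (Pi\<^sub>E I A) (\<Psi> \<omega>) \<partial>M) = 0" using box[OF A] by simp
    then have "(\<integral>\<omega>. P \<omega> * indicator (Pi\<^sub>E I A) (\<Psi> \<omega>) \<partial>M) = (\<integral>\<omega>. Q \<omega> * indicator (Pi\<^sub>E I A) (\<Psi> \<omega>) \<partial>M)"
      using inti[OF int(1) Pi] inti[OF int(2) Pi] by (simp add: R_eq left_diff_distrib)
    then show "emeasure (\<mu> P) (Pi\<^sub>E I A) = emeasure (\<mu> Q) (Pi\<^sub>E I A)"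
      using \<mu>[OF int(1) nonneg(1) Pi] \<mu>[OF int(2) nonneg(2) Pi] by simp
  qed auto
  then have "ennreal (\<integral>\<omega>. P \<omega> * indicator B (\<Psi> \<omega>) \<partial>M) = ennreal (\<integral>\<omega>. Q \<omega> * indicator B (\<Psi> \<omega>) \<partial>M)"
    using \<mu>[OF int(1) nonneg(1) B] \<mu>[OF int(2) nonneg(2) B] by simp
  then have "(\<integral>\<omega>. P \<omega> * indicator B (\<Psi> \<omega>) \<partial>M) = (\<integral>\<omega>. Q \<omega> * indicator B (\<Psi> \<omega>) \<partial>M)"
    using nonneg by (subst (asm) ennreal_inj) (auto intro!: integral_nonneg_AE)
  then show ?thesis
    using inti[OF int(1) B] inti[OF int(2) B] by (simp add: R_eq left_diff_distrib \<Psi>_def)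
qed

context online_learning
begin

section \<open>The filter error along the random inputs\<close>

abbreviation "inputs \<omega> \<equiv> \<lambda>j. x j \<omega>"

definition filter_error :: "nat \<Rightarrow> 'a \<Rightarrow> real^'d" where
  "filter_error n \<omega> = kalman_error (inputs \<omega>) n \<omega>"

text \<open>The error as a function of input path, weight and noise path, the form of integrand that
  \<open>input_integral\<close> takes.\<close>

definition model_error :: "nat \<Rightarrow> (nat \<Rightarrow> real^'d) \<times> (real^'d) \<times> (nat \<Rightarrow> real) \<Rightarrow> real^'d" where
  "model_error n = (\<lambda>(c, v, \<eta>). v - estimate Sw s2 c (\<lambda>j. v \<bullet> c j + \<eta> j) n)"

lemma model_error_kalman_error: "model_error n (c, w \<omega>, \<lambda>j. \<epsilon> j \<omega>) = kalman_error c n \<omega>"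
  by (simp add: model_error_def kalman_error_def)

lemma measurable_model_components [measurable]:
  "(\<lambda>p. fst p j) \<in> borel_measurable model_space"
  "(\<lambda>p. fst (snd p)) \<in> borel_measurable model_space"
  "(\<lambda>p. snd (snd p) j) \<in> borel_measurable model_space"
proof -
  show "(\<lambda>p. fst p j) \<in> borel_measurable model_space"
    by (rule measurable_compose[OF measurable_fst measurable_component_singleton]) simp
  show "(\<lambda>p. fst (snd p)) \<in> borel_measurable model_space"
    by (rule measurable_compose[OF measurable_snd measurable_fst])
  show "(\<lambda>p. snd (snd p) j) \<in> borel_measurable model_space"
    by (rule measurable_compose[OF measurable_compose[OF measurable_snd measurable_snd]
          measurable_component_singleton]) simp
qed

lemma measurable_model_error [measurable]: "model_error n \<in> borel_measurable model_space"
proof -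
  have "(\<lambda>p. estimate Sw s2 (\<lambda>j. fst p j) (\<lambda>j. fst (snd p) \<bullet> fst p j + snd (snd p) j) n)
      \<in> borel_measurable model_space"
    by (rule measurable_estimate[OF psd_Sw s2_pos]) measurable
  then have "(\<lambda>p. fst (snd p) - estimate Sw s2 (\<lambda>j. fst p j) (\<lambda>j. fst (snd p) \<bullet> fst p j + snd (snd p) j) n)
      \<in> borel_measurable model_space"
    by measurable
  then show ?thesis by (simp add: model_error_def case_prod_beta')
qed

lemma measurable_S [measurable]: "(\<lambda>\<omega>. S (inputs \<omega>) n) \<in> borel_measurable M"
  by (rule measurable_error_cov[OF psd_Sw s2_pos]) simp

lemma measurable_filter_error [measurable]: "filter_error n \<in> borel_measurable M"
proof -
  have "(\<lambda>\<omega>. estimate Sw s2 (inputs \<omega>) (\<lambda>j. w \<omega> \<bullet> x j \<omega> + \<epsilon> j \<omega>) n) \<in> borel_measurable M"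
    by (rule measurable_estimate[OF psd_Sw s2_pos]) measurable
  then show ?thesis unfolding filter_error_def[abs_def] kalman_error_def by measurable
qed

text \<open>For a frozen input path the second moment is the form of the covariance, at most that of
  \<open>Sw\<close>; this bound is the same for all paths.\<close>

lemma square_integrable_filter_error: "(\<lambda>\<omega>. a \<bullet> filter_error n \<omega>) \<in> square_integrable M"
proof -
  have "(\<integral>\<^sup>+\<omega>. ennreal ((a \<bullet> filter_error n \<omega>)\<^sup>2) \<partial>M)
      = (\<integral>\<^sup>+\<omega>'. (\<integral>\<^sup>+\<omega>. ennreal ((a \<bullet> kalman_error (inputs \<omega>') n \<omega>)\<^sup>2) \<partial>M) \<partial>M)"
    using input_nn_integral[of "\<lambda>p. ennreal ((a \<bullet> model_error n p)\<^sup>2)"]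
    by (simp add: model_error_kalman_error filter_error_def)
  also have "\<dots> = (\<integral>\<^sup>+\<omega>'. ennreal (a \<bullet> (S (inputs \<omega>') n *v a)) \<partial>M)"
  proof (rule nn_integral_cong)
    fix \<omega>'
    have "integrable M (\<lambda>\<omega>. (a \<bullet> kalman_error (inputs \<omega>') n \<omega>)\<^sup>2)"
      using square_integrable_linear_obs[OF kalman_error_linear_obs] by (simp add: square_integrable_def)
    then show "(\<integral>\<^sup>+\<omega>. ennreal ((a \<bullet> kalman_error (inputs \<omega>') n \<omega>)\<^sup>2) \<partial>M)
        = ennreal (a \<bullet> (S (inputs \<omega>') n *v a))"
      using kalman_error_covariance[of a "inputs \<omega>'" n a]
      by (subst nn_integral_eq_integral) (auto simp: power2_eq_square)
  qed
  also have "\<dots> \<le> (\<integral>\<^sup>+\<omega>'. ennreal (a \<bullet> (Sw *v a)) \<partial>M)"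
    by (intro nn_integral_mono ennreal_leI error_cov_form_le psd_Sw s2_pos)
  also have "\<dots> < \<infinity>" by (simp add: emeasure_space_1)
  finally have "integrable M (\<lambda>\<omega>. (a \<bullet> filter_error n \<omega>)\<^sup>2)"
    by (intro integrableI_nonneg) auto
  then show ?thesis by (simp add: square_integrable_def)
qed

lemma filter_error_second_moment:
  "(\<integral>\<omega>. (a \<bullet> filter_error n \<omega>)\<^sup>2 \<partial>M) = (\<integral>\<omega>. a \<bullet> (S (inputs \<omega>) n *v a) \<partial>M)"
proof -
  have "integrable M (\<lambda>\<omega>. (a \<bullet> filter_error n \<omega>)\<^sup>2)"
    using square_integrable_filter_error[of a n] by (simp add: square_integrable_def)
  then have "(\<integral>\<omega>. (a \<bullet> filter_error n \<omega>)\<^sup>2 \<partial>M)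
      = (\<integral>\<omega>'. (\<integral>\<omega>. (a \<bullet> kalman_error (inputs \<omega>') n \<omega>)\<^sup>2 \<partial>M) \<partial>M)"
    using input_integral[of "\<lambda>p. (a \<bullet> model_error n p)\<^sup>2"]
    by (simp add: model_error_kalman_error filter_error_def)
  then show ?thesis by (simp add: power2_eq_square kalman_error_covariance)
qed

lemma integrable_filter_error: "integrable M (\<lambda>\<omega>. a \<bullet> filter_error n \<omega>)"
  using square_integrable_filter_error[of a n] by (auto simp: square_integrable_def intro: integrable_of_square)

text \<open>Once the inputs are frozen their indicators are constants and leave the inner integral,
  which \<open>kalman_error_char\<close> makes 0. They can therefore be absorbed into the weight
  \<open>?Z\<close>, and uniqueness of characteristic functions is applied to the outputs
  alone.\<close>

lemma filter_error_box:
  assumes A: "\<And>j. j < n \<Longrightarrow> A j \<in> sets borel" and B: "\<And>j. j < n \<Longrightarrow> B j \<in> sets borel"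
  shows "(\<integral>\<omega>. (a \<bullet> filter_error n \<omega>) * ((\<Prod>j<n. indicator (A j) (x j \<omega>))
            * (\<Prod>j<n. indicator (B j) (w \<omega> \<bullet> x j \<omega> + \<epsilon> j \<omega>))) \<partial>M) = 0"
proof -
  define F :: "(nat \<Rightarrow> real^'d) \<Rightarrow> real" where "F = (\<lambda>c. \<Prod>j<n. indicator (A j) (c j))"
  have [measurable]: "(\<lambda>p. F (fst p)) \<in> borel_measurable model_space"
    using A unfolding F_def
    by (intro borel_measurable_prod measurable_compose[OF measurable_model_components(1)]) auto
  have F_M: "(\<lambda>\<omega>. F (inputs \<omega>)) \<in> borel_measurable M"
    using A unfolding F_def
    by (intro borel_measurable_prod measurable_compose[OF measurable_sources(2)]) auto
  have F_le: "\<bar>F c\<bar> \<le> 1" for c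
    unfolding abs_prod F_def by (intro prod_le_1) (auto simp: indicator_def)
  let ?Z = "\<lambda>\<omega>. complex_of_real ((a \<bullet> filter_error n \<omega>) * F (inputs \<omega>))"
  have Z_int: "integrable M ?Z"
  proof (rule integrable_of_real, rule Bochner_Integration.integrable_bound[OF integrable_filter_error[of a n]])
    show "(\<lambda>\<omega>. (a \<bullet> filter_error n \<omega>) * F (inputs \<omega>)) \<in> borel_measurable M"
      by (intro borel_measurable_times F_M borel_measurable_integrable[OF integrable_filter_error])
    show "AE \<omega> in M. norm ((a \<bullet> filter_error n \<omega>) * F (inputs \<omega>)) \<le> norm (a \<bullet> filter_error n \<omega>)"
      by (intro AE_I2) (simp add: abs_mult mult_left_le[OF F_le])
  qed
  have obs[measurable]: "(\<lambda>\<omega>. w \<omega> \<bullet> x j \<omega> + \<epsilon> j \<omega>) \<in> borel_measurable M" for j by measurable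
  have "(\<integral>\<omega>. ?Z \<omega> * (\<Prod>j<n. indicator (B j) (w \<omega> \<bullet> x j \<omega> + \<epsilon> j \<omega>)) \<partial>M) = 0"
  proof (rule integral_prod_indicator_eq_0[OF Z_int obs _ B])
    fix b :: "nat \<Rightarrow> real"
    define h where "h = (\<lambda>p. complex_of_real ((a \<bullet> model_error n p) * F (fst p))
        * iexp (\<Sum>j<n. b j * (fst (snd p) \<bullet> fst p j + snd (snd p) j)))"
    have h: "h (inputs \<omega>', w \<omega>, \<lambda>j. \<epsilon> j \<omega>)
        = complex_of_real (F (inputs \<omega>')) * (complex_of_real (a \<bullet> kalman_error (inputs \<omega>') n \<omega>)
            * iexp (\<Sum>j<n. b j * (w \<omega> \<bullet> x j \<omega>' + \<epsilon> j \<omega>)))" for \<omega> \<omega>'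
      by (simp add: h_def model_error_kalman_error del: of_real_sum of_real_prod)
    have h': "h (inputs \<omega>, w \<omega>, \<lambda>j. \<epsilon> j \<omega>)
        = ?Z \<omega> * iexp (\<Sum>j<n. b j * (w \<omega> \<bullet> x j \<omega> + \<epsilon> j \<omega>))" for \<omega>
      unfolding h filter_error_def by (simp del: of_real_sum)
    have h_meas: "h \<in> borel_measurable model_space"
      unfolding h_def by measurable
    have "(\<lambda>\<omega>. \<Sum>j<n. b j * (w \<omega> \<bullet> x j \<omega> + \<epsilon> j \<omega>)) \<in> borel_measurable M"
      by measurable
    then have e_meas: "(\<lambda>\<omega>. iexp (\<Sum>j<n. b j * (w \<omega> \<bullet> x j \<omega> + \<epsilon> j \<omega>))) \<in> borel_measurable M"
      by measurable
    have "integrable M (\<lambda>\<omega>. ?Z \<omega> * iexp (\<Sum>j<n. b j * (w \<omega> \<bullet> x j \<omega> + \<epsilon> j \<omega>)))"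
    proof (rule Bochner_Integration.integrable_bound[OF Z_int])
      show "(\<lambda>\<omega>. ?Z \<omega> * iexp (\<Sum>j<n. b j * (w \<omega> \<bullet> x j \<omega> + \<epsilon> j \<omega>))) \<in> borel_measurable M"
        by (rule borel_measurable_times[OF borel_measurable_integrable[OF Z_int] e_meas])
    qed (simp only: norm_iexp_mult order_refl, simp)
    then have "integrable M (\<lambda>\<omega>. h (inputs \<omega>, w \<omega>, \<lambda>j. \<epsilon> j \<omega>))"
      unfolding h' .
    then have "(\<integral>\<omega>. h (inputs \<omega>, w \<omega>, \<lambda>j. \<epsilon> j \<omega>) \<partial>M)
        = (\<integral>\<omega>'. (\<integral>\<omega>. h (inputs \<omega>', w \<omega>, \<lambda>j. \<epsilon> j \<omega>) \<partial>M) \<partial>M)"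
      by (rule input_integral[OF h_meas])
    also have "\<dots> = 0"
      unfolding h integral_mult_right_zero kalman_error_char by simp
    finally show "(\<integral>\<omega>. ?Z \<omega> * iexp (\<Sum>j<n. b j * (w \<omega> \<bullet> x j \<omega> + \<epsilon> j \<omega>)) \<partial>M) = 0"
      unfolding h' .
  qed
  also have "(\<integral>\<omega>. ?Z \<omega> * (\<Prod>j<n. indicator (B j) (w \<omega> \<bullet> x j \<omega> + \<epsilon> j \<omega>)) \<partial>M)
      = (\<integral>\<omega>. complex_of_real ((a \<bullet> filter_error n \<omega>) * (F (inputs \<omega>)
            * (\<Prod>j<n. indicator (B j) (w \<omega> \<bullet> x j \<omega> + \<epsilon> j \<omega>)))) \<partial>M)"
    by (simp add: of_real_indicator mult.assoc)
  finally show ?thesis by (simp only: integral_complex_of_real of_real_eq_0_iff F_def)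
qed

section \<open>The information algebra and the conditional expectation\<close>

text \<open>The updates are functions of the data, so conditioning on them adds no information.\<close>
definition data_var :: "source \<Rightarrow> 'a \<Rightarrow> real^'d" where
  "data_var s \<omega> = (case s of Weight \<Rightarrow> 0 | Input j \<Rightarrow> x j \<omega> | Noise j \<Rightarrow> vec (w \<omega> \<bullet> x j \<omega> + \<epsilon> j \<omega>))"

abbreviation "data_index n \<equiv> Input ` {..<n} \<union> Noise ` {..<n}"

definition data_algebra :: "nat \<Rightarrow> 'a measure" where
  "data_algebra n = vimage_algebra (space M) (\<lambda>\<omega>. \<lambda>s\<in>data_index n. data_var s \<omega>) (PiM (data_index n) (\<lambda>_. borel))"

lemma measurable_data_var: "data_var s \<in> borel_measurable M"
proof (cases s)
  case (Noise j)
  have "(\<lambda>\<omega>. vec (w \<omega> \<bullet> x j \<omega> + \<epsilon> j \<omega>) :: real^'d) \<in> borel_measurable M" by measurable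
  then show ?thesis using Noise by (simp add: data_var_def[abs_def])
qed (simp_all add: data_var_def[abs_def])

lemma filter_error_data_algebra:
  assumes "E \<in> sets (data_algebra n)"
  shows "(\<integral>\<omega>. (a \<bullet> filter_error n \<omega>) * indicator E \<omega> \<partial>M) = 0"
proof -
  let ?I = "data_index n"
  obtain B where B: "B \<in> sets (PiM ?I (\<lambda>_. borel))" and E: "E = (\<lambda>\<omega>. \<lambda>s\<in>?I. data_var s \<omega>) -` B \<inter> space M"
    using assms unfolding data_algebra_def
    by (subst (asm) sets_vimage_algebra2) (auto simp: space_PiM)
  have "(\<integral>\<omega>. (a \<bullet> filter_error n \<omega>) * indicator B (\<lambda>s\<in>?I. data_var s \<omega>) \<partial>M) = 0"
  proof (rule integral_indicator_PiM_eq_0[OF _ integrable_filter_error _ _ B])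
    show "data_var s \<in> borel_measurable M" for s by (rule measurable_data_var)
    fix A :: "source \<Rightarrow> (real^'d) set" assume A: "\<And>s. s \<in> ?I \<Longrightarrow> A s \<in> sets borel"
    have "(\<Prod>s\<in>?I. indicator (A s) (data_var s \<omega>) :: real)
        = (\<Prod>j<n. indicator (A (Input j)) (x j \<omega>)) * (\<Prod>j<n. indicator (vec -` A (Noise j)) (w \<omega> \<bullet> x j \<omega> + \<epsilon> j \<omega>))" for \<omega>
      by (subst prod.union_disjoint)
        (auto simp: prod.reindex inj_on_def data_var_def indicator_def)
    moreover have "vec -` A (Noise j) \<in> sets borel" if "j < n" for j
      using measurable_sets[OF borel_measurable_vec A[of "Noise j"]] that by simp
    ultimately show "(\<integral>\<omega>. (a \<bullet> filter_error n \<omega>) * (\<Prod>s\<in>?I. indicator (A s) (data_var s \<omega>)) \<partial>M) = 0"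
      using filter_error_box[of n "\<lambda>j. A (Input j)" "\<lambda>j. vec -` A (Noise j)" a] A by simp
  qed simp
  also have "(\<integral>\<omega>. (a \<bullet> filter_error n \<omega>) * indicator B (\<lambda>s\<in>?I. data_var s \<omega>) \<partial>M)
      = (\<integral>\<omega>. (a \<bullet> filter_error n \<omega>) * indicator E \<omega> \<partial>M)"
    by (intro Bochner_Integration.integral_cong) (auto simp: E indicator_def)
  finally show ?thesis .
qed

lemma space_data_algebra [simp]: "space (data_algebra n) = space M"
  by (simp add: data_algebra_def)

lemma measurable_data_component:
  assumes "s \<in> data_index n"
  shows "data_var s \<in> borel_measurable (data_algebra n)"
proof -
  have "(\<lambda>\<omega>. \<lambda>s\<in>data_index n. data_var s \<omega>) \<in> measurable (data_algebra n) (PiM (data_index n) (\<lambda>_. borel))"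
    unfolding data_algebra_def by (rule measurable_vimage_algebra1) (auto simp: space_PiM)
  from measurable_compose[OF this measurable_component_singleton[OF assms]]
  show ?thesis using assms by simp
qed

lemma measurable_data_x: "j < n \<Longrightarrow> x j \<in> borel_measurable (data_algebra n)"
  using measurable_data_component[of "Input j" n] by (simp add: data_var_def[abs_def])

lemma measurable_data_y:
  assumes "j < n"
  shows "y j \<in> borel_measurable (data_algebra n)"
proof -
  have "(\<lambda>\<omega>. data_var (Noise j) \<omega> $ undefined) \<in> borel_measurable (data_algebra n)"
    using assms by (intro borel_measurable_vec_nth measurable_data_component) auto
  then show ?thesis
    by (rule measurable_cong[THEN iffD1, rotated]) (simp add: data_var_def y_output)
qed

lemma measurable_info_of_components:
  assumes "\<And>j. j \<le> k \<Longrightarrow> x j \<in> borel_measurable N" "\<And>j. j \<le> k \<Longrightarrow> y j \<in> borel_measurable N"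
    and "\<And>j. j < k \<Longrightarrow> u j \<in> borel_measurable N"
  shows "info x y u k \<in> measurable N (info_space k)"
proof -
  have "(\<lambda>\<omega>. (x j \<omega>, y j \<omega>)) \<in> borel_measurable N" if "j \<le> k" for j
    using assms(1,2)[OF that] by measurable
  then show ?thesis
    using assms(3) unfolding info_def[abs_def] info_space_def
    by (intro measurable_Pair measurable_restrict) auto
qed

text \<open>The information at time j contains only the updates before j, so strong induction
  resolves the mutual dependence of updates and information.\<close>

lemma measurable_data_u:
  assumes "j < n"
  shows "u j \<in> borel_measurable (data_algebra n)"
  using assms
proof (induction j rule: less_induct)
  case (less j)
  have info: "info x y u j \<in> measurable (data_algebra n) (info_space j)"
    using less by (intro measurable_info_of_components measurable_data_x measurable_data_y) auto
  obtain f where f_meas: "f \<in> borel_measurable (info_space j)"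
      and f: "\<And>\<omega>. \<omega> \<in> space M \<Longrightarrow> u j \<omega> = f (info x y u j \<omega>)"
    using u_update by blast
  have "(\<lambda>\<omega>. f (info x y u j \<omega>)) \<in> borel_measurable (data_algebra n)"
    by (rule measurable_compose[OF info f_meas])
  then show ?case
    by (rule measurable_cong[THEN iffD1, rotated]) (simp add: f)
qed

abbreviation "info_algebra k \<equiv> vimage_algebra (space M) (info x y u k) (info_space k)"

text \<open>The information at time k holds k + 1 inputs and outputs, hence \<open>Suc k\<close>.
  Orthogonality on the data algebra is inherited along this inclusion.\<close>

lemma sets_info_algebra: "sets (info_algebra k) \<subseteq> sets (data_algebra (Suc k))"
  by (intro sets_image_in_sets measurable_info_of_components measurable_data_x measurable_data_y
      measurable_data_u) simp_all

lemma sets_data_algebra: "sets (data_algebra n) \<subseteq> sets M"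
  unfolding data_algebra_def
  by (intro sets_image_in_sets measurable_restrict measurable_data_var) auto

lemma
  assumes "j \<le> k"
  shows measurable_info_x: "x j \<in> borel_measurable (info_algebra k)"
    and measurable_info_y: "y j \<in> borel_measurable (info_algebra k)"
proof -
  have "info x y u k \<in> measurable (info_algebra k) (info_space k)"
    by (rule measurable_vimage_algebra1) (auto simp: info_def info_space_def space_pair_measure space_PiM)
  moreover have "(\<lambda>p. fst p j) \<in> borel_measurable (info_space k)"
    unfolding info_space_def using assms
    by (intro measurable_compose[OF measurable_fst measurable_component_singleton]) auto
  ultimately have "(\<lambda>\<omega>. fst (info x y u k \<omega>) j) \<in> borel_measurable (info_algebra k)"
    by (rule measurable_compose)
  then have xy: "(\<lambda>\<omega>. (x j \<omega>, y j \<omega>)) \<in> borel_measurable (info_algebra k)"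
    using assms by (simp add: info_def)
  then have "(\<lambda>\<omega>. (x j \<omega>, y j \<omega>)) \<in> measurable (info_algebra k) (borel \<Otimes>\<^sub>M borel)"
    by (simp add: borel_prod)
  from measurable_compose[OF this measurable_fst] measurable_compose[OF this measurable_snd]
  show "x j \<in> borel_measurable (info_algebra k)" "y j \<in> borel_measurable (info_algebra k)"
    by simp_all
qed

text \<open>The recursive estimate at the observed outputs is measurable for the information
  algebra, and its error integrates to 0 over every information event; these two properties
  characterise the conditional expectation.\<close>

lemma kalman_estimate_AE:
  "AE \<omega> in M. w \<omega> - kalman_estimate M w x y u k \<omega> = filter_error (Suc k) \<omega>"
proof -
  let ?F = "info_algebra k"
  let ?m = "\<lambda>\<omega>. estimate Sw s2 (inputs \<omega>) (\<lambda>j. y j \<omega>) (Suc k)"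
  have sub: "subalgebra M ?F"
    using sets_info_algebra sets_data_algebra by (auto simp: subalgebra_def)
  then interpret sigma_finite_subalgebra M ?F
    by (intro finite_measure_subalgebra_is_sigma_finite finite_measure_subalgebra.intro
        finite_measure_subalgebra_axioms.intro finite_measure_axioms)
  have m_F: "?m \<in> borel_measurable ?F"
    by (rule measurable_estimate[OF psd_Sw s2_pos]) (auto intro: measurable_info_x measurable_info_y)
  have m_eq: "?m \<omega> = w \<omega> - filter_error (Suc k) \<omega>" if "\<omega> \<in> space M" for \<omega>
    using y_output[OF that] by (simp add: filter_error_def kalman_error_def del: estimate.simps)
  have "AE \<omega> in M. real_cond_exp M ?F (\<lambda>\<omega>. w \<omega> $ i) \<omega> = ?m \<omega> $ i" for i
  proof (rule real_cond_exp_charact)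
    have e_int: "integrable M (\<lambda>\<omega>. filter_error (Suc k) \<omega> $ i)"
      using integrable_filter_error[of "axis i 1"] by (simp add: inner_axis')
    show w_int: "integrable M (\<lambda>\<omega>. w \<omega> $ i)"
      using w_mean integrable_bounded_linear[OF bounded_linear_vec_nth] by (auto simp: has_bochner_integral_iff)
    have m_M: "(\<lambda>\<omega>. ?m \<omega> $ i) \<in> borel_measurable M"
      by (intro borel_measurable_vec_nth measurable_from_subalg[OF sub m_F])
    show "integrable M (\<lambda>\<omega>. ?m \<omega> $ i)"
      using Bochner_Integration.integrable_diff[OF w_int e_int]
      by (rule Bochner_Integration.integrable_cong[THEN iffD1, rotated -1]) (simp_all add: m_eq del: estimate.simps)
    show "(\<lambda>\<omega>. ?m \<omega> $ i) \<in> borel_measurable ?F"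
      by (rule borel_measurable_vec_nth[OF m_F])
    fix A assume A: "A \<in> sets ?F"
    then have A_M: "A \<in> sets M" using sub by (auto simp: subalgebra_def)
    have "(\<integral>\<omega>. filter_error (Suc k) \<omega> $ i * indicator A \<omega> \<partial>M) = 0"
      using filter_error_data_algebra[of A "Suc k" "axis i 1"] A sets_info_algebra[of k] by (auto simp: inner_axis')
    moreover have "(\<integral>\<omega>\<in>A. ?m \<omega> $ i \<partial>M) = (\<integral>\<omega>. w \<omega> $ i * indicator A \<omega> - filter_error (Suc k) \<omega> $ i * indicator A \<omega> \<partial>M)"
      unfolding set_lebesgue_integral_def
      by (intro Bochner_Integration.integral_cong) (auto simp: m_eq left_diff_distrib right_diff_distrib mult.commute simp del: estimate.simps)
    ultimately show "(\<integral>\<omega>\<in>A. w \<omega> $ i \<partial>M) = (\<integral>\<omega>\<in>A. ?m \<omega> $ i \<partial>M)"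
      using integrable_real_mult_indicator[OF A_M w_int] integrable_real_mult_indicator[OF A_M e_int]
      by (simp add: set_lebesgue_integral_def mult.commute)
  qed
  \<comment> \<open>There are finitely many coordinates, so their exceptional null sets can be
    united.\<close>
  then have "AE \<omega> in M. \<forall>i\<in>UNIV. real_cond_exp M ?F (\<lambda>\<omega>. w \<omega> $ i) \<omega> = ?m \<omega> $ i"
    by (intro AE_finite_allI) auto
  then show ?thesis
  proof (rule AE_mp[OF _ AE_I2], intro impI)
    fix \<omega> assume \<omega>: "\<omega> \<in> space M" "\<forall>i\<in>UNIV. real_cond_exp M ?F (\<lambda>\<omega>. w \<omega> $ i) \<omega> = ?m \<omega> $ i"
    then have "kalman_estimate M w x y u k \<omega> = ?m \<omega>"
      unfolding kalman_estimate_def by (simp add: vec_eq_iff del: estimate.simps)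
    then show "w \<omega> - kalman_estimate M w x y u k \<omega> = filter_error (Suc k) \<omega>"
      using m_eq[OF \<omega>(1)] by simp
  qed
qed

end

section \<open>Decay of the error covariance and of the gain\<close>

lemma error_cov_cong: "(\<And>j. j < n \<Longrightarrow> c j = c' j) \<Longrightarrow> error_cov Sw s2 c n = error_cov Sw s2 c' n"
  by (induction n) simp_all

text \<open>A point outside the support has a null neighbourhood, which shrinks to a member of a
  countable basis; the complement thus lies in a countable union of null sets.\<close>

lemma AE_measure_support:
  fixes \<mu> :: "'b::second_countable_topology measure"
  assumes [simp]: "sets \<mu> = sets borel"
  shows "AE p in \<mu>. p \<in> measure_support \<mu>"
proof -
  obtain B :: "'b set set" where B: "countable B" "topological_basis B"
    using ex_countable_basis by blast
  let ?N = "\<Union>{b \<in> B. emeasure \<mu> b = 0}"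
  have "b \<in> sets \<mu>" if "b \<in> B" for b
    using topological_basis_open[OF B(2) that] by simp
  then have "?N \<in> null_sets \<mu>"
    using B(1) by (intro null_sets_UN'[of _ "\<lambda>b. b", simplified]) (auto intro: null_setsI)
  moreover have "{p \<in> space \<mu>. p \<notin> measure_support \<mu>} \<subseteq> ?N"
  proof clarify
    fix p assume "p \<notin> measure_support \<mu>"
    then obtain U where U: "open U" "p \<in> U" "emeasure \<mu> U = 0"
      by (auto simp: measure_support_def)
    then obtain b where b: "b \<in> B" "p \<in> b" "b \<subseteq> U"
      using topological_basisE[OF B(2)] by metis
    then have "emeasure \<mu> b = 0"
      using U emeasure_mono[of b U \<mu>] by simp
    with b show "p \<in> ?N" by blast
  qed
  ultimately show ?thesis by (rule AE_I')
qed

text \<open>Since the sequence decreases, the decrements \<open>\<kappa> * (a j)\<^sup>2\<close> for \<open>j < k\<close> are all at least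
  \<open>\<kappa> * (a k)\<^sup>2\<close>, and they telescope.\<close>
lemma quadratic_decrease_bound:
  fixes a :: "nat \<Rightarrow> real"
  assumes nonneg: "\<And>j. 0 \<le> a j" and \<kappa>: "0 < \<kappa>" and step: "\<And>j. \<kappa> * (a j)\<^sup>2 \<le> a j - a (Suc j)"
  shows "real k * \<kappa> * (a k)\<^sup>2 \<le> a 0"
proof -
  have "real k * \<kappa> * (a k)\<^sup>2 \<le> a 0 - a k"
  proof (induction k)
    case (Suc k)
    have "a (Suc k) \<le> a k"
      using step[of k] \<kappa> by (meson diff_ge_0_iff_ge mult_nonneg_nonneg less_imp_le order_trans zero_le_power2)
    then have "(a (Suc k))\<^sup>2 \<le> (a k)\<^sup>2"
      using nonneg by (intro power_mono)
    \<comment> \<open>After this comparison k of the k + 1 equal terms go to the induction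
      hypothesis, and the last one is covered by the new decrement.\<close>
    then have "real (Suc k) * \<kappa> * (a (Suc k))\<^sup>2 \<le> real (Suc k) * \<kappa> * (a k)\<^sup>2"
      using \<kappa> by (intro mult_left_mono) auto
    then show ?case using Suc step[of k] by (simp add: algebra_simps)
  qed simp
  then show ?thesis using nonneg[of k] by linarith
qed

context online_learning
begin

section \<open>The mean trace of the covariance\<close>

lemma S_entry_le: "\<bar>S c n $ i $ j\<bar> \<le> trace Sw"
  using psd_entry_le_trace[OF psd_error_cov[OF psd_Sw s2_pos], of c n i j]
    trace_error_cov_le[OF psd_Sw s2_pos, of c n] by linarith

lemma trace_S_bounds: "0 \<le> trace (S c n)" "trace (S c n) \<le> trace Sw"
  using psd_trace_nonneg[OF psd_error_cov[OF psd_Sw s2_pos]] trace_error_cov_le[OF psd_Sw s2_pos]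
  by auto

lemma measurable_S_entry [measurable]: "(\<lambda>\<omega>. S (inputs \<omega>) n $ i $ j) \<in> borel_measurable M"
  by (intro borel_measurable_vec_nth measurable_S)

lemma integrable_S_entry: "integrable M (\<lambda>\<omega>. S (inputs \<omega>) n $ i $ j)"
  by (rule integrable_const_bound[where B = "trace Sw"]) (auto simp: S_entry_le)

lemma integrable_S: "integrable M (\<lambda>\<omega>. S (inputs \<omega>) n)"
  by (intro integrable_vec integrable_S_entry)

lemma integrable_trace_S: "integrable M (\<lambda>\<omega>. trace (S (inputs \<omega>) n))"
  unfolding trace_def by (intro Bochner_Integration.integrable_sum integrable_S_entry)

definition mean_trace :: "nat \<Rightarrow> real" where
  "mean_trace n = (\<integral>\<omega>. trace (S (inputs \<omega>) n) \<partial>M)"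

lemma mean_trace_nonneg: "0 \<le> mean_trace n"
  unfolding mean_trace_def by (intro integral_nonneg_AE AE_I2 trace_S_bounds)

lemma trace_integral_cond_cov: "trace (\<integral>\<omega>. cond_cov Sw s2 x k \<omega> \<partial>M) = mean_trace (Suc k)"
proof -
  have "(\<integral>\<omega>. S (inputs \<omega>) n \<partial>M) $ i $ i = (\<integral>\<omega>. S (inputs \<omega>) n $ i $ i \<partial>M)" for n i
    using integral_vec_nth[OF integrable_S] integral_vec_nth[OF integrable_bounded_linear[OF bounded_linear_vec_nth integrable_S]]
    by simp
  then show ?thesis
    using integrable_S_entry
    by (simp add: cond_cov_eq mean_trace_def trace_def del: error_cov.simps)
qed

lemma kalman_mse_eq: "kalman_mse M w x y u k = mean_trace (Suc k)"
proof -
  let ?e = "filter_error (Suc k)"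
  have "kalman_mse M w x y u k = (\<integral>\<omega>. ?e \<omega> \<bullet> ?e \<omega> \<partial>M)"
    unfolding kalman_mse_def
  proof (rule integral_cong_AE)
    show "AE \<omega> in M. (w \<omega> - kalman_estimate M w x y u k \<omega>) \<bullet> (w \<omega> - kalman_estimate M w x y u k \<omega>) = ?e \<omega> \<bullet> ?e \<omega>"
      using kalman_estimate_AE[of k] by eventually_elim simp
    have "kalman_estimate M w x y u k \<in> borel_measurable M"
      unfolding borel_measurable_vec_iff kalman_estimate_def by simp
    then show "(\<lambda>\<omega>. (w \<omega> - kalman_estimate M w x y u k \<omega>) \<bullet> (w \<omega> - kalman_estimate M w x y u k \<omega>)) \<in> borel_measurable M"
      by measurable
  qed measurable
  also have "\<dots> = (\<integral>\<omega>. (\<Sum>i\<in>UNIV. (axis i 1 \<bullet> ?e \<omega>)\<^sup>2) \<partial>M)"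
    by (simp add: inner_vec_def[of "filter_error _ _"] inner_axis' power2_eq_square)
  also have "\<dots> = (\<Sum>i\<in>UNIV. \<integral>\<omega>. (axis i 1 \<bullet> ?e \<omega>)\<^sup>2 \<partial>M)"
    using square_integrable_filter_error by (intro Bochner_Integration.integral_sum) (simp add: square_integrable_def)
  also have "\<dots> = (\<Sum>i\<in>UNIV. \<integral>\<omega>. S (inputs \<omega>) (Suc k) $ i $ i \<partial>M)"
    by (simp only: filter_error_second_moment inner_axis_mult)
  also have "\<dots> = mean_trace (Suc k)"
    unfolding mean_trace_def trace_def
    by (rule Bochner_Integration.integral_sum[symmetric]) (rule integrable_S_entry)
  finally show ?thesis .
qed

section \<open>Bounds and second moments of the inputs\<close>

lemma input_norm_bound:
  obtains R where "0 < R" "\<And>k. AE \<omega> in M. norm (x k \<omega>) \<le> R"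
proof -
  obtain R where R: "\<And>p. p \<in> measure_support (distr M borel (x 0)) \<Longrightarrow> norm p \<le> R"
    using x_bounded[of 0] by (auto simp: bounded_iff)
  \<comment> \<open>The maximum makes the bound positive. One R serves all times because the inputs
    share their law.\<close>
  have "AE \<omega> in M. norm (x k \<omega>) \<le> max 1 R" for k
  proof -
    have "AE p in distr M borel (x k). p \<in> measure_support (distr M borel (x k))"
      by (rule AE_measure_support) simp
    then have "AE p in distr M borel (x k). norm p \<le> R"
      by eventually_elim (use R x_ident[of k] in simp)
    then have "AE \<omega> in M. norm (x k \<omega>) \<le> R"
      by (rule AE_distrD[OF measurable_sources(2)])
    then show ?thesis by eventually_elim simp
  qed
  then show thesis by (intro that[of "max 1 R"]) auto
qed

lemma quadratic_form_entry:
  fixes c :: "real^'d"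
  shows "((rowvector c :: real^'d^1) ** A ** transpose (rowvector c :: real^'d^1)) $ 1 $ 1 = c \<bullet> (A *v c)"
  unfolding transpose_rowvector
  by (metis dot_matrix_product dot_rowvector_columnvector matrix_mul_assoc)

text \<open>The limits are drawn from the rate, which requires some admissible constant; boundedness
  of the inputs provides it.\<close>

lemma input_bound_exists: "\<exists>c1. input_bound M Sw x c1"
proof -
  obtain R where R: "0 < R" "\<And>k. AE \<omega> in M. norm (x k \<omega>) \<le> R"
    using input_norm_bound by blast
  obtain B where B: "\<And>v. norm (Sw *v v) \<le> norm v * B" "B > 0"
    using bounded_linear.pos_bounded[OF matrix_vector_mul_bounded_linear[of Sw]] by blast
  have "AE \<omega> in M. x (Suc k) \<omega> \<bullet> (Sw *v x (Suc k) \<omega>) \<le> R * (R * B)" for k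
    using R(2)[of "Suc k"]
  proof eventually_elim
    case (elim \<omega>)
    let ?x = "x (Suc k) \<omega>"
    have "?x \<bullet> (Sw *v ?x) \<le> norm ?x * norm (Sw *v ?x)" by (rule norm_cauchy_schwarz)
    also have "\<dots> \<le> norm ?x * (norm ?x * B)" by (intro mult_left_mono B) simp
    also have "\<dots> \<le> R * (R * B)" using elim R(1) B(2) by (intro mult_mono) auto
    finally show ?case .
  qed
  then have "input_bound M Sw x (R * (R * B))"
    using R(1) B(2) unfolding input_bound_def quadratic_form_entry by simp
  then show ?thesis by blast
qed

lemma integrable_input_products: "integrable M (\<lambda>\<omega>. x k \<omega> $ i * x k \<omega> $ j)"
proof -
  obtain R where R: "0 < R" "\<And>k. AE \<omega> in M. norm (x k \<omega>) \<le> R"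
    using input_norm_bound by blast
  show ?thesis
  proof (rule integrable_const_bound[where B = "R * R"])
    show "AE \<omega> in M. norm (x k \<omega> $ i * x k \<omega> $ j) \<le> R * R"
      using R(2)[of k]
    proof eventually_elim
      case (elim \<omega>)
      then have "\<bar>x k \<omega> $ i\<bar> \<le> R" "\<bar>x k \<omega> $ j\<bar> \<le> R"
        using component_le_norm_cart[of "x k \<omega>"] order_trans by blast+
      then show ?case using R(1) by (simp add: abs_mult mult_mono)
    qed
    show "(\<lambda>\<omega>. x k \<omega> $ i * x k \<omega> $ j) \<in> borel_measurable M"
      by (intro borel_measurable_times borel_measurable_vec_nth measurable_sources)
  qed
qed

lemma input_second_moment:
  "integrable M (\<lambda>\<omega>. (v \<bullet> x k \<omega>)\<^sup>2)" "(\<integral>\<omega>. (v \<bullet> x k \<omega>)\<^sup>2 \<partial>M) = v \<bullet> (Q *v v)"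
proof -
  have int_outer: "integrable M (\<lambda>\<omega>. outer (x k \<omega>) (x k \<omega>))"
    by (intro integrable_vec) (simp add: outer_entry integrable_input_products)
  have entry: "Q $ i $ j = (\<integral>\<omega>. x k \<omega> $ i * x k \<omega> $ j \<partial>M)" for i j
    unfolding x_second_moment[of k, symmetric]
    using int_outer integrable_bounded_linear[OF bounded_linear_vec_nth int_outer]
    by (simp add: integral_vec_nth outer_entry)
  have sq: "(v \<bullet> x k \<omega>)\<^sup>2 = (\<Sum>i\<in>UNIV. \<Sum>j\<in>UNIV. (v $ i * v $ j) * (x k \<omega> $ i * x k \<omega> $ j))" for \<omega>
    by (simp add: inner_vec_def power2_eq_square sum_product mult_ac)
  show "integrable M (\<lambda>\<omega>. (v \<bullet> x k \<omega>)\<^sup>2)"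
    unfolding sq using integrable_input_products by simp
  have "(\<integral>\<omega>. (v \<bullet> x k \<omega>)\<^sup>2 \<partial>M) = (\<Sum>i\<in>UNIV. \<Sum>j\<in>UNIV. (v $ i * v $ j) * Q $ i $ j)"
    unfolding sq using integrable_input_products by (simp add: entry)
  also have "\<dots> = v \<bullet> (Q *v v)"
    by (simp add: inner_vec_def matrix_vector_mult_def sum_distrib_left mult_ac)
  finally show "(\<integral>\<omega>. (v \<bullet> x k \<omega>)\<^sup>2 \<partial>M) = v \<bullet> (Q *v v)" .
qed

text \<open>The next input is independent of the covariance, so averaging turns the squared product
  with a row into the form of \<open>Q\<close> at that row, bounded below through
  \<open>lambda_min Q\<close>. \<open>trace_square_bound\<close> then replaces the row norms by the
  trace.\<close>

lemma
  shows integrable_gain_norm: "integrable M (\<lambda>\<omega>. \<Sum>h\<in>UNIV. (S (inputs \<omega>) n $ h \<bullet> x n \<omega>)\<^sup>2)"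
    and gain_norm_lower_bound: "lambda_min Q / CARD('d) * (mean_trace n)\<^sup>2
      \<le> (\<integral>\<omega>. (\<Sum>h\<in>UNIV. (S (inputs \<omega>) n $ h \<bullet> x n \<omega>)\<^sup>2) \<partial>M)"
proof -
  obtain R where R: "0 < R" "\<And>k. AE \<omega> in M. norm (x k \<omega>) \<le> R"
    using input_norm_bound by blast
  have [measurable]: "(\<lambda>\<omega>. S (inputs \<omega>) n $ h) \<in> borel_measurable M" for h
    by (intro borel_measurable_vec_nth measurable_S)
  have row_le: "norm (S c n $ h) \<le> real CARD('d) * trace Sw" for c h
    using norm_le_l1_cart[of "S c n $ h"] sum_bounded_above[of UNIV "\<lambda>j. \<bar>S c n $ h $ j\<bar>" "trace Sw"]
    by (simp add: S_entry_le)
  show int: "integrable M (\<lambda>\<omega>. \<Sum>h\<in>UNIV. (S (inputs \<omega>) n $ h \<bullet> x n \<omega>)\<^sup>2)"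
  proof (intro Bochner_Integration.integrable_sum integrable_const_bound)
    fix h
    show "AE \<omega> in M. norm ((S (inputs \<omega>) n $ h \<bullet> x n \<omega>)\<^sup>2) \<le> (real CARD('d) * trace Sw * R)\<^sup>2"
      using R(2)[of n]
    proof eventually_elim
      case (elim \<omega>)
      have "\<bar>S (inputs \<omega>) n $ h \<bullet> x n \<omega>\<bar> \<le> norm (S (inputs \<omega>) n $ h) * norm (x n \<omega>)"
        by (rule Cauchy_Schwarz_ineq2)
      also have "\<dots> \<le> real CARD('d) * trace Sw * R"
        using row_le elim psd_trace_nonneg[OF psd_Sw] by (intro mult_mono) auto
      finally have "\<bar>S (inputs \<omega>) n $ h \<bullet> x n \<omega>\<bar>\<^sup>2 \<le> (real CARD('d) * trace Sw * R)\<^sup>2"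
        by (intro power_mono) auto
      then show ?case by simp
    qed
  qed measurable
  have trace_sq: "integrable M (\<lambda>\<omega>. (trace (S (inputs \<omega>) n))\<^sup>2)"
    using borel_measurable_integrable[OF integrable_trace_S]
    by (intro integrable_const_bound[where B = "(trace Sw)\<^sup>2"] AE_I2)
      (auto simp: trace_S_bounds power_mono)
  define g where "g = (\<lambda>p :: (nat \<Rightarrow> real^'d) \<times> (real^'d). \<Sum>h\<in>UNIV. (S (fst p) n $ h \<bullet> snd p)\<^sup>2)"
  have "(\<lambda>p :: (nat \<Rightarrow> real^'d) \<times> (real^'d). S (\<lambda>j. fst p j) n)
      \<in> borel_measurable (PiM {..<n} (\<lambda>_. borel) \<Otimes>\<^sub>M borel)"
    by (rule measurable_error_cov[OF psd_Sw s2_pos])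
      (rule measurable_compose[OF measurable_fst measurable_component_singleton], simp)
  then have [measurable]: "(\<lambda>p :: (nat \<Rightarrow> real^'d) \<times> (real^'d). S (fst p) n $ h)
      \<in> borel_measurable (PiM {..<n} (\<lambda>_. borel) \<Otimes>\<^sub>M borel)" for h
    by (intro borel_measurable_vec_nth) simp
  have g_meas: "g \<in> borel_measurable (PiM {..<n} (\<lambda>_. borel) \<Otimes>\<^sub>M borel)"
    unfolding g_def by measurable
  \<comment> \<open>The first n steps of the recursion read only inputs before n, so truncating the
    path changes nothing.\<close>
  have restr: "S (\<lambda>j\<in>{..<n}. x j \<omega>) n = S (inputs \<omega>) n" for \<omega>
    by (rule error_cov_cong) simp
  have "(\<integral>\<omega>. (\<Sum>h\<in>UNIV. (S (inputs \<omega>) n $ h \<bullet> x n \<omega>)\<^sup>2) \<partial>M)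
      = (\<integral>\<omega>'. (\<integral>\<omega>. (\<Sum>h\<in>UNIV. (S (inputs \<omega>') n $ h \<bullet> x n \<omega>)\<^sup>2) \<partial>M) \<partial>M)"
    using next_input_integral[OF g_meas] int by (simp add: g_def restr)
  also have "\<dots> = (\<integral>\<omega>. (\<Sum>h\<in>UNIV. S (inputs \<omega>) n $ h \<bullet> (Q *v (S (inputs \<omega>) n $ h))) \<partial>M)"
    by (simp add: input_second_moment)
  also have "\<dots> \<ge> (\<integral>\<omega>. lambda_min Q / CARD('d) * (trace (S (inputs \<omega>) n))\<^sup>2 \<partial>M)"
  proof (rule integral_mono)
    show "integrable M (\<lambda>\<omega>. lambda_min Q / CARD('d) * (trace (S (inputs \<omega>) n))\<^sup>2)"
      by (intro integrable_mult_right trace_sq)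
    have "integrable M (\<lambda>\<omega>. S (inputs \<omega>) n $ h $ i * S (inputs \<omega>) n $ h $ j)" for h i j
      by (rule integrable_const_bound[where B = "trace Sw * trace Sw"])
        (auto simp: abs_mult intro!: mult_mono S_entry_le psd_trace_nonneg psd_Sw)
    moreover have "v \<bullet> (Q *v v) = (\<Sum>i\<in>UNIV. \<Sum>j\<in>UNIV. Q $ i $ j * (v $ i * v $ j))" for v
      by (simp add: inner_vec_def matrix_vector_mult_def sum_distrib_left mult_ac)
    ultimately show "integrable M (\<lambda>\<omega>. \<Sum>h\<in>UNIV. S (inputs \<omega>) n $ h \<bullet> (Q *v (S (inputs \<omega>) n $ h)))"
      by simp
    fix \<omega>
    have "lambda_min Q / CARD('d) * (trace (S (inputs \<omega>) n))\<^sup>2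
        = lambda_min Q * ((trace (S (inputs \<omega>) n))\<^sup>2 / CARD('d))" by simp
    also have "\<dots> \<le> lambda_min Q * (\<Sum>h\<in>UNIV. S (inputs \<omega>) n $ h \<bullet> S (inputs \<omega>) n $ h)"
      using lambda_min_pos[OF Q_pos_def] by (intro mult_left_mono trace_square_bound) auto
    also have "\<dots> \<le> (\<Sum>h\<in>UNIV. S (inputs \<omega>) n $ h \<bullet> (Q *v (S (inputs \<omega>) n $ h)))"
      unfolding sum_distrib_left by (intro sum_mono lambda_min_le[OF Q_pos_def])
    finally show "lambda_min Q / CARD('d) * (trace (S (inputs \<omega>) n))\<^sup>2
        \<le> (\<Sum>h\<in>UNIV. S (inputs \<omega>) n $ h \<bullet> (Q *v (S (inputs \<omega>) n $ h)))" .
  qed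
  also have "(\<integral>\<omega>. lambda_min Q / CARD('d) * (trace (S (inputs \<omega>) n))\<^sup>2 \<partial>M)
      = lambda_min Q / CARD('d) * (\<integral>\<omega>. (trace (S (inputs \<omega>) n))\<^sup>2 \<partial>M)"
    by simp
  finally have "lambda_min Q / CARD('d) * (\<integral>\<omega>. (trace (S (inputs \<omega>) n))\<^sup>2 \<partial>M)
      \<le> (\<integral>\<omega>. (\<Sum>h\<in>UNIV. (S (inputs \<omega>) n $ h \<bullet> x n \<omega>)\<^sup>2) \<partial>M)" .
  \<comment> \<open>This is nonnegativity of the variance of the trace.\<close>
  moreover have "(mean_trace n)\<^sup>2 \<le> (\<integral>\<omega>. (trace (S (inputs \<omega>) n))\<^sup>2 \<partial>M)"
    using variance_eq[OF integrable_trace_S trace_sq] variance_positive[of "\<lambda>\<omega>. trace (S (inputs \<omega>) n)"]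
    by (simp add: mean_trace_def)
  then have "lambda_min Q / CARD('d) * (mean_trace n)\<^sup>2
      \<le> lambda_min Q / CARD('d) * (\<integral>\<omega>. (trace (S (inputs \<omega>) n))\<^sup>2 \<partial>M)"
    using lambda_min_pos[OF Q_pos_def] by (intro mult_left_mono) auto
  ultimately show "lambda_min Q / CARD('d) * (mean_trace n)\<^sup>2
      \<le> (\<integral>\<omega>. (\<Sum>h\<in>UNIV. (S (inputs \<omega>) n $ h \<bullet> x n \<omega>)\<^sup>2) \<partial>M)"
    by linarith
qed

text \<open>\<open>input_bound\<close> concerns \<open>x (Suc k)\<close>, the input that carries the
  covariance from time k to time k + 1; the decrease is therefore claimed from time 0 on and not
  from time -1.\<close>

lemma mean_trace_decrease:
  assumes "input_bound M Sw x c1"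
  shows "lambda_min Q / (CARD('d) * (c1 + s2)) * (mean_trace (Suc k))\<^sup>2
           \<le> mean_trace (Suc k) - mean_trace (Suc (Suc k))"
proof -
  have c1: "0 < c1" "AE \<omega> in M. x (Suc k) \<omega> \<bullet> (Sw *v x (Suc k) \<omega>) \<le> c1"
    using assms unfolding input_bound_def quadratic_form_entry by auto
  let ?N = "\<lambda>\<omega>. \<Sum>h\<in>UNIV. (S (inputs \<omega>) (Suc k) $ h \<bullet> x (Suc k) \<omega>)\<^sup>2"
  have "(\<integral>\<omega>. ?N \<omega> / (c1 + s2) \<partial>M)
      \<le> (\<integral>\<omega>. trace (S (inputs \<omega>) (Suc k)) - trace (S (inputs \<omega>) (Suc (Suc k))) \<partial>M)"
  proof (rule integral_mono_AE)
    show "AE \<omega> in M. ?N \<omega> / (c1 + s2) \<le> trace (S (inputs \<omega>) (Suc k)) - trace (S (inputs \<omega>) (Suc (Suc k)))"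
      using c1(2)
    proof eventually_elim
      case (elim \<omega>)
      let ?x = "x (Suc k) \<omega>"
      have "?x \<bullet> (S (inputs \<omega>) (Suc k) *v ?x) \<le> c1"
        using error_cov_form_le[OF psd_Sw s2_pos, of ?x "inputs \<omega>" "Suc k"] elim by linarith
      then have "?N \<omega> / (c1 + s2) \<le> ?N \<omega> / (?x \<bullet> (S (inputs \<omega>) (Suc k) *v ?x) + s2)"
        using error_cov_denominator_pos[OF psd_Sw s2_pos, of ?x "inputs \<omega>" "Suc k"]
          c1(1) s2_pos
        by (intro divide_left_mono mult_pos_pos sum_nonneg zero_le_power2) linarith+
      then show ?case
        unfolding trace_error_cov_Suc[OF psd_Sw s2_pos, of "inputs \<omega>" "Suc k"] by linarith
    qed
    show "integrable M (\<lambda>\<omega>. ?N \<omega> / (c1 + s2))"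
      by (rule integrable_divide_zero) (rule integrable_gain_norm)
    show "integrable M (\<lambda>\<omega>. trace (S (inputs \<omega>) (Suc k)) - trace (S (inputs \<omega>) (Suc (Suc k))))"
      by (intro Bochner_Integration.integrable_diff integrable_trace_S)
  qed
  also have "\<dots> = mean_trace (Suc k) - mean_trace (Suc (Suc k))"
    unfolding mean_trace_def by (intro Bochner_Integration.integral_diff integrable_trace_S)
  finally have "(\<integral>\<omega>. ?N \<omega> \<partial>M) / (c1 + s2) \<le> mean_trace (Suc k) - mean_trace (Suc (Suc k))"
    by (simp only: integral_divide_zero)
  moreover have "lambda_min Q / CARD('d) * (mean_trace (Suc k))\<^sup>2 / (c1 + s2) \<le> (\<integral>\<omega>. ?N \<omega> \<partial>M) / (c1 + s2)"
    using gain_norm_lower_bound[of "Suc k"] c1(1) s2_pos by (intro divide_right_mono) auto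
  ultimately show ?thesis by simp
qed

lemma mean_trace_le:
  assumes c1: "input_bound M Sw x c1" and k: "1 \<le> k"
  shows "mean_trace (Suc k) \<le> sqrt ((c1 + s2) * real CARD('d) * mean_trace (Suc 0) / (real k * lambda_min Q))"
proof -
  define \<kappa> where "\<kappa> = lambda_min Q / (CARD('d) * (c1 + s2))"
  have pos: "0 < c1 + s2" "0 < lambda_min Q"
    using c1 s2_pos lambda_min_pos[OF Q_pos_def] by (auto simp: input_bound_def)
  then have \<kappa>: "0 < \<kappa>" by (simp add: \<kappa>_def)
  \<comment> \<open>The shifted sequence starts at \<open>mean_trace (Suc 0)\<close>, which belongs
    to time 0.\<close>
  have "real k * \<kappa> * (mean_trace (Suc k))\<^sup>2 \<le> mean_trace (Suc 0)"
    by (rule quadratic_decrease_bound[of "\<lambda>k. mean_trace (Suc k)", OF mean_trace_nonneg \<kappa>])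
      (unfold \<kappa>_def, rule mean_trace_decrease[OF c1])
  then have "(mean_trace (Suc k))\<^sup>2 \<le> mean_trace (Suc 0) / (real k * \<kappa>)"
    using k \<kappa> by (simp add: pos_le_divide_eq mult.commute[of "(mean_trace (Suc k))\<^sup>2"])
  also have "\<dots> = (c1 + s2) * real CARD('d) * mean_trace (Suc 0) / (real k * lambda_min Q)"
    using pos by (simp add: \<kappa>_def)
  finally show ?thesis by (rule real_le_rsqrt)
qed

lemma mean_trace_tendsto: "(\<lambda>k. mean_trace (Suc k)) \<longlonglongrightarrow> 0"
proof -
  obtain c1 where c1: "input_bound M Sw x c1" using input_bound_exists by blast
  define D where "D = (c1 + s2) * real CARD('d) * mean_trace (Suc 0) / lambda_min Q"
  have "(\<lambda>k. sqrt (D * inverse (real k))) \<longlonglongrightarrow> sqrt (D * 0)"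
    by (intro tendsto_real_sqrt tendsto_mult tendsto_const lim_inverse_n)
  then have lim: "(\<lambda>k. sqrt (D * inverse (real k))) \<longlonglongrightarrow> 0" by simp
  have le: "\<forall>\<^sub>F k in sequentially. mean_trace (Suc k) \<le> sqrt (D * inverse (real k))"
    using eventually_ge_at_top[of 1]
  proof eventually_elim
    case (elim k)
    have "(c1 + s2) * real CARD('d) * mean_trace (Suc 0) / (real k * lambda_min Q) = D * inverse (real k)"
      by (simp add: D_def divide_inverse)
    then show ?case using mean_trace_le[OF c1 elim] by simp
  qed
  show ?thesis
    by (rule tendsto_sandwich[OF _ le tendsto_const lim]) (simp add: mean_trace_nonneg)
qed

section \<open>The Kalman gain\<close>

lemma kalman_gain_entry: "kalman_gain Sw s2 x k \<omega> $ h $ l = (S (inputs \<omega>) (Suc k) $ h \<bullet> x k \<omega>) / s2"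
proof -
  have l: "l = 1" by (rule num1_eq1)
  have "(A ** mat t) $ h $ l = A $ h $ l * t" for A :: "real^1^'d" and t :: real
    unfolding l by (simp add: matrix_matrix_mult_def mat_def)
  moreover have "(A ** transpose (rowvector c :: real^'d^1)) $ h $ l = A $ h \<bullet> c" for A :: "real^'d^'d" and c
    by (simp add: matrix_matrix_mult_def transpose_def rowvector_def inner_vec_def)
  ultimately show ?thesis
    unfolding kalman_gain_def cond_cov_eq using s2_pos
    by (subst matrix_inv_mat_1) (auto simp del: error_cov.simps)
qed

text \<open>The covariance at time k already depends on \<open>x k\<close>, so independence does not
  separate the two factors. The almost sure bound on the inputs is used instead and leaves the
  trace; the absolute value inside the integral serves both the limit of the means and Markov's
  inequality.\<close>

lemma kalman_gain_entry_bound: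
  obtains C where "0 < C"
    "\<And>k h l. integrable M (\<lambda>\<omega>. kalman_gain Sw s2 x k \<omega> $ h $ l)"
    "\<And>k h l. (\<integral>\<omega>. \<bar>kalman_gain Sw s2 x k \<omega> $ h $ l\<bar> \<partial>M) \<le> C * mean_trace (Suc k)"
proof -
  obtain R where R: "0 < R" "\<And>k. AE \<omega> in M. norm (x k \<omega>) \<le> R"
    using input_norm_bound by blast
  define C where "C = real CARD('d) * R / s2"
  have C: "0 < C" using R(1) s2_pos by (simp add: C_def)
  have bound: "AE \<omega> in M. \<bar>kalman_gain Sw s2 x k \<omega> $ h $ l\<bar> \<le> C * trace (S (inputs \<omega>) (Suc k))" for k h l
    using R(2)[of k]
  proof eventually_elim
    case (elim \<omega>)
    let ?S = "S (inputs \<omega>) (Suc k)"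
    have "norm (?S $ h) \<le> real CARD('d) * trace ?S"
      using norm_le_l1_cart[of "?S $ h"] sum_bounded_above[of UNIV "\<lambda>j. \<bar>?S $ h $ j\<bar>" "trace ?S"]
        psd_entry_le_trace[OF psd_error_cov[OF psd_Sw s2_pos]]
      by (simp del: error_cov.simps)
    then have "norm (?S $ h) * norm (x k \<omega>) \<le> (real CARD('d) * trace ?S) * R"
      using elim trace_S_bounds(1)[of "inputs \<omega>" "Suc k"]
      by (intro mult_mono) (auto simp del: error_cov.simps)
    then have "\<bar>?S $ h \<bullet> x k \<omega>\<bar> \<le> (real CARD('d) * trace ?S) * R"
      using Cauchy_Schwarz_ineq2 order_trans by blast
    then have "\<bar>?S $ h \<bullet> x k \<omega>\<bar> / s2 \<le> (real CARD('d) * trace ?S) * R / s2"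
      using s2_pos by (intro divide_right_mono) auto
    then show ?case
      using s2_pos by (simp add: kalman_gain_entry C_def mult_ac del: error_cov.simps)
  qed
  have int: "integrable M (\<lambda>\<omega>. kalman_gain Sw s2 x k \<omega> $ h $ l)" for k h l
  proof (rule Bochner_Integration.integrable_bound)
    show "integrable M (\<lambda>\<omega>. C * trace (S (inputs \<omega>) (Suc k)))"
      by (intro integrable_mult_right integrable_trace_S)
    show "(\<lambda>\<omega>. kalman_gain Sw s2 x k \<omega> $ h $ l) \<in> borel_measurable M"
      unfolding kalman_gain_entry
      by (intro borel_measurable_divide borel_measurable_inner borel_measurable_vec_nth measurable_S
          measurable_sources borel_measurable_const)
    show "AE \<omega> in M. norm (kalman_gain Sw s2 x k \<omega> $ h $ l) \<le> norm (C * trace (S (inputs \<omega>) (Suc k)))"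
      using bound[of k h l] by eventually_elim (simp del: error_cov.simps)
  qed
  have "(\<integral>\<omega>. \<bar>kalman_gain Sw s2 x k \<omega> $ h $ l\<bar> \<partial>M) \<le> C * mean_trace (Suc k)" for k h l
  proof -
    have "(\<integral>\<omega>. \<bar>kalman_gain Sw s2 x k \<omega> $ h $ l\<bar> \<partial>M) \<le> (\<integral>\<omega>. C * trace (S (inputs \<omega>) (Suc k)) \<partial>M)"
      by (intro integral_mono_AE integrable_abs int integrable_mult_right integrable_trace_S bound)
    then show ?thesis by (simp add: mean_trace_def del: error_cov.simps)
  qed
  with C int show thesis by (rule that)
qed

lemma kalman_gain_mean_tendsto: "(\<lambda>k. \<integral>\<omega>. kalman_gain Sw s2 x k \<omega> \<partial>M) \<longlonglongrightarrow> 0"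
proof (intro vec_tendstoI)
  fix h l
  obtain C where C: "\<And>k h l. integrable M (\<lambda>\<omega>. kalman_gain Sw s2 x k \<omega> $ h $ l)"
    "\<And>k h l. (\<integral>\<omega>. \<bar>kalman_gain Sw s2 x k \<omega> $ h $ l\<bar> \<partial>M) \<le> C * mean_trace (Suc k)"
    using kalman_gain_entry_bound by metis
  have row: "integrable M (\<lambda>\<omega>. kalman_gain Sw s2 x k \<omega> $ h)" for k h
    by (intro integrable_vec C(1))
  have "(\<integral>\<omega>. kalman_gain Sw s2 x k \<omega> \<partial>M) $ h $ l = (\<integral>\<omega>. kalman_gain Sw s2 x k \<omega> $ h $ l \<partial>M)" for k
    using integral_vec_nth[OF integrable_vec[OF row]] integral_vec_nth[OF row] by metis
  moreover have "\<bar>\<integral>\<omega>. kalman_gain Sw s2 x k \<omega> $ h $ l \<partial>M\<bar> \<le> C * mean_trace (Suc k)" for k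
    by (rule order_trans[OF integral_abs_bound C(2)])
  then have "\<forall>\<^sub>F k in sequentially. norm (\<integral>\<omega>. kalman_gain Sw s2 x k \<omega> $ h $ l \<partial>M) \<le> C * mean_trace (Suc k)"
    by (intro always_eventually allI) (simp only: real_norm_def)
  then have "(\<lambda>k. \<integral>\<omega>. kalman_gain Sw s2 x k \<omega> $ h $ l \<partial>M) \<longlonglongrightarrow> 0"
    by (rule Lim_null_comparison[OF _ tendsto_mult_right_zero[OF mean_trace_tendsto]])
  ultimately show "(\<lambda>k. (\<integral>\<omega>. kalman_gain Sw s2 x k \<omega> \<partial>M) $ h $ l) \<longlonglongrightarrow> 0 $ h $ l"
    by (simp only: zero_index)
qed

lemma kalman_gain_tendsto_in_probability:
  assumes "0 < \<delta>"
  shows "(\<lambda>k. prob {\<omega> \<in> space M. \<bar>kalman_gain Sw s2 x k \<omega> $ h $ l\<bar> > \<delta>}) \<longlonglongrightarrow> 0"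
proof -
  obtain C where C: "\<And>k h l. integrable M (\<lambda>\<omega>. kalman_gain Sw s2 x k \<omega> $ h $ l)"
    "\<And>k h l. (\<integral>\<omega>. \<bar>kalman_gain Sw s2 x k \<omega> $ h $ l\<bar> \<partial>M) \<le> C * mean_trace (Suc k)"
    using kalman_gain_entry_bound by metis
  have "prob {\<omega> \<in> space M. \<bar>kalman_gain Sw s2 x k \<omega> $ h $ l\<bar> > \<delta>} \<le> C * mean_trace (Suc k) / \<delta>" for k
  proof -
    note [measurable] = borel_measurable_integrable[OF C(1)[of k h l]]
    \<comment> \<open>Markov's inequality bounds the event with the weak inequality, which contains
      the strict one.\<close>
    have "prob {\<omega> \<in> space M. \<bar>kalman_gain Sw s2 x k \<omega> $ h $ l\<bar> > \<delta>}
        \<le> prob {\<omega> \<in> space M. \<bar>kalman_gain Sw s2 x k \<omega> $ h $ l\<bar> \<ge> \<delta>}"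
      by (intro finite_measure_mono) auto
    also have "\<dots> \<le> (\<integral>\<omega>. \<bar>kalman_gain Sw s2 x k \<omega> $ h $ l\<bar> \<partial>M) / \<delta>"
      using assms C(1) by (intro integral_Markov_inequality_measure[where A = "space M"]) auto
    also have "\<dots> \<le> C * mean_trace (Suc k) / \<delta>"
      using assms C(2) by (intro divide_right_mono) auto
    finally show ?thesis .
  qed
  then have le: "\<forall>\<^sub>F k in sequentially.
      prob {\<omega> \<in> space M. \<bar>kalman_gain Sw s2 x k \<omega> $ h $ l\<bar> > \<delta>} \<le> C * mean_trace (Suc k) / \<delta>"
    by (rule always_eventually[OF allI])
  have lim: "(\<lambda>k. C * mean_trace (Suc k) / \<delta>) \<longlonglongrightarrow> 0"
    using tendsto_divide[OF tendsto_mult_right_zero[OF mean_trace_tendsto, of C] tendsto_const[of \<delta>]] assms by simp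
  show ?thesis
    by (rule tendsto_sandwich[OF _ le tendsto_const lim]) simp
qed

end

text \<open>Existence of an admissible \<open>c1\<close> is a conjunct of its own, so that the rate
  is not vacuous.\<close>

theorem proposition5:
  fixes M :: "'a measure"
    and w :: "'a \<Rightarrow> real^'d"
    and x u what :: "nat \<Rightarrow> 'a \<Rightarrow> real^'d"
    and \<epsilon> y :: "nat \<Rightarrow> 'a \<Rightarrow> real"
    and Sw Q :: "real^'d^'d"
    and s2 :: real
  assumes "online_learning M w x \<epsilon> y u what Sw Q s2"
  shows
    "(\<forall>k. kalman_mse M w x y u k = trace (\<integral>\<omega>. cond_cov Sw s2 x k \<omega> \<partial>M))
     \<and> (\<exists>c1. input_bound M Sw x c1)
     \<and> (\<forall>c1. input_bound M Sw x c1 \<longrightarrow>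
          (\<forall>k\<ge>1. trace (\<integral>\<omega>. cond_cov Sw s2 x k \<omega> \<partial>M)
            \<le> sqrt ((c1 + s2) * real CARD('d) * trace (\<integral>\<omega>. cond_cov Sw s2 x 0 \<omega> \<partial>M)
                    / (real k * lambda_min Q))))
     \<and> (\<lambda>k. kalman_mse M w x y u k) \<longlonglongrightarrow> 0
     \<and> (\<lambda>k. \<integral>\<omega>. kalman_gain Sw s2 x k \<omega> \<partial>M) \<longlonglongrightarrow> 0
     \<and> (\<forall>h l. \<forall>\<delta>>0.
          (\<lambda>k. measure M {\<omega> \<in> space M. \<bar>kalman_gain Sw s2 x k \<omega> $ h $ l\<bar> > \<delta>}) \<longlonglongrightarrow> 0)"
proof -
  interpret online_learning M w x \<epsilon> y u what Sw Q s2 by (rule assms)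
  show ?thesis
    unfolding trace_integral_cond_cov kalman_mse_eq
    using input_bound_exists mean_trace_le mean_trace_tendsto kalman_gain_mean_tendsto
      kalman_gain_tendsto_in_probability
    by (intro conjI allI impI) simp_all
qed

end
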